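(* Let $E$ be a finite set of items with random realization $\Phi\sim p$, let $M\subseteq G$ be a set of $m$ training tasks, let $0<l<k$ be integers, and suppose that the (not necessarily monotone) non-negative utility function $f^i$ is adaptive submodular for every task $i\in M$. Let $\pi^{r}$ be the two-phase randomized greedy policy with parameters $l,k$, and let $\pi^{o}$ be an optimal policy for the adaptive submodular meta-learning problem $\max_{S\subseteq E,\,|S|=l}\ \max_{\pi\in\Omega(S,k)} f_{avg}(\pi)$. Then $$f_{avg}(\pi^{r})\ \ge\ \frac12\Bigl(1-\frac1l\Bigr)^{l}\Bigl(1-\frac1{k-l}\Bigr)^{k-l} f_{avg}(\pi^{o}).$$
   Context: Items and states. $E$ is a finite set of $n$ items and $O$ a set of states. A realization is a function $\phi:E\to O$; $\Phi$ denotes the random realization, distributed according to a known (discrete) prior $p$. A partial realization $\psi$ is a function from a subset $\mathrm{dom}(\psi)\subseteq E$ to $O$; $\Phi\sim\psi$ means that $\Phi$ agrees with $\psi$ on $\mathrm{dom}(\psi)$; $\psi\subseteq\psi'$ means $\mathrm{dom}(\psi)\subseteq\mathrm{dom}(\psi')$ and the two agree on $\mathrm{dom}(\psi)$. Only partial realizations with $\Pr[\Phi\sim\psi]>0$ are considered. An item's state is observed only upon selecting it. Tasks. $G$ is a family of tasks; each $i\in G$ has a utility function $f^i:2^E\times O^E\to\mathbb{R}_{\ge 0}$. $M\subseteq G$ is a set of $m$ training tasks. All expectations appearing are assumed finite. For $Y\subseteq E$, $f^i(Y)=\mathbb{E}_{\Phi\sim p}[f^i(Y,\Phi)]$. The conditional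 expected marginal utility is $\Delta_i(e\mid\psi)=\mathbb{E}[f^i(\mathrm{dom}(\psi)\cup\{e\},\Phi)-f^i(\mathrm{dom}(\psi),\Phi)\mid\Phi\sim\psi]$. $f^i$ is adaptive submodular if $\Delta_i(e\mid\psi)\ge\Delta_i(e\mid\psi')$ for all $\psi\subseteq\psi'$ and $e\in E\setminus\mathrm{dom}(\psi')$. Policies. A (possibly randomized) adaptive policy $\pi$ chooses the next item to select (or stops) based on the current task and the partial realization observed so far. $E(\pi,\phi,i)$ is the (random) set of items it selects under realization $\phi$ for task $i$. $f^i_{avg}(\pi)=\mathbb{E}[f^i(E(\pi,\Phi,i),\Phi)]$, the expectation being over $\Phi\sim p$ and the internal randomness of $\pi$ (independent of $\Phi$), and $f_{avg}(\pi)=\frac1m\sum_{i\in M}f^i_{avg}(\pi)$. $\Omega(S,k)$ is the set of policies that, for every task, first select all items of $S$ (the same $S$ for all tasks), then may adaptively select further items depending on the task and observed states, with $|E(\pi,\phi,i)|\le k$ for all $\phi$ with $p(\phi)>0$. Two-phase randomized greedy policy $\pi^r$. Add a set $D$ of $k$ dummy items, each of which always has zero marginal utility (so they may be removed from any set without changing its utility); let $E'=E\cup D$. Initialization: start with $S^r=\emptyset$; in each of $l$ rounds, let $U(S^r)\subseteq E'$ be a set of $l$ items with the largest values of $\frac1m\sum_{i\in M}(f^i(S^r\cup\{e\})-f^i(S^r))$, and add to $S^r$ an item sampled uniformly at random from $U(S^r)$. Execution for an incoming task $i$: select all of $S^r$ and observe their states, giving $\psi^{r_l}$; then in each of the $k-l$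 rounds $t=l+1,\dots,k$ let $U(\psi^{r_{t-1}})\subseteq E'$ be a set of $k-l$ items with the largest values of $\Delta_i(e\mid\psi^{r_{t-1}})$, select an item $e_t$ sampled uniformly at random from $U(\psi^{r_{t-1}})$, observe its state, and set $\psi^{r_t}=\psi^{r_{t-1}}\cup\{\phi(e_t)\}$. Ties are broken arbitrarily. *)

theory Defs
  imports "HOL-Probability.Probability"
begin

section \<open>Realizations and adaptive submodularity\<close>

text \<open>
  Items have type \<open>'e\<close>, states \<open>'o\<close>, tasks \<open>'g\<close>. A realization is a function in
  \<open>E \<rightarrow>\<^sub>E Os\<close>, the prior is a \<open>pmf\<close> on realizations, and a partial realization is a map
  \<open>'e \<rightharpoonup> 'o\<close>, so that the relation "\<open>\<psi>\<close> is contained in \<open>\<psi>'\<close>" is the library's \<open>\<psi> \<subseteq>\<^sub>m \<psi>'\<close>.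
\<close>

type_synonym ('e, 'o) realization = "'e \<Rightarrow> 'o"
type_synonym ('e, 'o) utility = "'e set \<Rightarrow> ('e, 'o) realization \<Rightarrow> real"

definition agreeing :: "('e \<rightharpoonup> 'o) \<Rightarrow> ('e, 'o) realization set" where
  "agreeing \<psi> = {\<phi>. \<psi> \<subseteq>\<^sub>m (Some \<circ> \<phi>)}"

text \<open>The partial realizations under consideration: those of positive probability.\<close>

definition partial_real ::
    "'e set \<Rightarrow> ('e, 'o) realization pmf \<Rightarrow> ('e \<rightharpoonup> 'o) \<Rightarrow> bool" where
  "partial_real E p \<psi> \<longleftrightarrow> dom \<psi> \<subseteq> E \<and> measure_pmf.prob p (agreeing \<psi>) > 0"

definition observed :: "('e, 'o) realization \<Rightarrow> 'e set \<Rightarrow> ('e \<rightharpoonup> 'o)" where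
  "observed \<phi> A = (Some \<circ> \<phi>) |` A"

definition exp_utility ::
    "('e, 'o) realization pmf \<Rightarrow> ('e, 'o) utility \<Rightarrow> 'e set \<Rightarrow> real" where
  "exp_utility p u Y = measure_pmf.expectation p (\<lambda>\<phi>. u Y \<phi>)"

definition marginal ::
    "('e, 'o) realization pmf \<Rightarrow> ('e, 'o) utility \<Rightarrow> ('e \<rightharpoonup> 'o) \<Rightarrow> 'e \<Rightarrow> real" where
  "marginal p u \<psi> e =
     measure_pmf.expectation (cond_pmf p (agreeing \<psi>))
       (\<lambda>\<phi>. u (dom \<psi> \<union> {e}) \<phi> - u (dom \<psi>) \<phi>)"

definition adaptive_submodular ::
    "'e set \<Rightarrow> ('e, 'o) realization pmf \<Rightarrow> ('e, 'o) utility \<Rightarrow> bool" where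
  "adaptive_submodular E p u \<longleftrightarrow>
     (\<forall>\<psi> \<psi>' e. partial_real E p \<psi> \<and> partial_real E p \<psi>' \<and> \<psi> \<subseteq>\<^sub>m \<psi>' \<and> e \<in> E - dom \<psi>' \<longrightarrow>
        marginal p u \<psi> e \<ge> marginal p u \<psi>' e)"

section \<open>Policies\<close>

text \<open>
  A randomized policy maps the task and the current partial realization to a distribution on
  the next item, where \<open>None\<close> means "stop".
\<close>

type_synonym ('g, 'e, 'o) policy = "'g \<Rightarrow> ('e \<rightharpoonup> 'o) \<Rightarrow> 'e option pmf"

primrec run_policy ::
    "(('e \<rightharpoonup> 'o) \<Rightarrow> 'e option pmf) \<Rightarrow> ('e, 'o) realization \<Rightarrow> nat \<Rightarrow> 'e set \<Rightarrow> 'e set pmf" where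
  "run_policy \<sigma> \<phi> 0 A = return_pmf A"
| "run_policy \<sigma> \<phi> (Suc n) A =
     bind_pmf (\<sigma> (observed \<phi> A))
       (\<lambda>d. case d of None \<Rightarrow> return_pmf A | Some e \<Rightarrow> run_policy \<sigma> \<phi> n (insert e A))"

text \<open>
  The distribution of the random set selected by a policy. A policy never selects an item twice
  (see \<open>is_policy\<close>), so it has stopped or exhausted \<open>E\<close> after \<open>card E\<close> steps.
\<close>

definition selected ::
    "'e set \<Rightarrow> ('g, 'e, 'o) policy \<Rightarrow> 'g \<Rightarrow> ('e, 'o) realization \<Rightarrow> 'e set pmf" where
  "selected E \<pi> i \<phi> = run_policy (\<pi> i) \<phi> (card E) {}"

definition is_policy ::
    "'e set \<Rightarrow> ('e, 'o) realization pmf \<Rightarrow> 'g set \<Rightarrow> ('g, 'e, 'o) policy \<Rightarrow> bool" where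
  "is_policy E p G \<pi> \<longleftrightarrow>
     (\<forall>i\<in>G. \<forall>\<psi>. partial_real E p \<psi> \<longrightarrow> set_pmf (\<pi> i \<psi>) \<subseteq> insert None (Some ` (E - dom \<psi>)))"

text \<open>
  The utility functionals take the law \<open>R\<close> of the selected set (given the task and the
  realization) as argument, so that they apply both to \<open>selected E \<pi>\<close> and to the two-phase greedy
  policy below. The selection is sampled given \<open>\<phi>\<close>, hence the iterated expectation.
\<close>

definition task_utility ::
    "('e, 'o) realization pmf \<Rightarrow> ('e, 'o) utility \<Rightarrow> (('e, 'o) realization \<Rightarrow> 'e set pmf) \<Rightarrow> real"
  where
  "task_utility p u R =
     measure_pmf.expectation p (\<lambda>\<phi>. measure_pmf.expectation (R \<phi>) (\<lambda>Y. u Y \<phi>))"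

definition avg_utility ::
    "('e, 'o) realization pmf \<Rightarrow> ('g \<Rightarrow> ('e, 'o) utility) \<Rightarrow> 'g set \<Rightarrow>
     ('g \<Rightarrow> ('e, 'o) realization \<Rightarrow> 'e set pmf) \<Rightarrow> real" where
  "avg_utility p f M R = (1 / real (card M)) * (\<Sum>i\<in>M. task_utility p (f i) (R i))"

text \<open>
  As long as only a proper subset of \<open>S\<close> has been selected, the next item must come from \<open>S\<close>.
  Starting from the empty partial realization, exactly such states occur before \<open>S\<close> is completed.
\<close>

definition \<Omega> ::
    "'e set \<Rightarrow> ('e, 'o) realization pmf \<Rightarrow> 'g set \<Rightarrow> 'e set \<Rightarrow> nat \<Rightarrow> ('g, 'e, 'o) policy set" where
  "\<Omega> E p G S k =
     {\<pi>. is_policy E p G \<pi> \<and>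
         (\<forall>i\<in>G. \<forall>\<psi>. partial_real E p \<psi> \<and> dom \<psi> \<subset> S \<longrightarrow>
            set_pmf (\<pi> i \<psi>) \<subseteq> Some ` (S - dom \<psi>)) \<and>
         (\<forall>i\<in>G. \<forall>\<phi>\<in>set_pmf p. \<forall>Y\<in>set_pmf (selected E \<pi> i \<phi>). card Y \<le> k)}"

definition optimal_policy ::
    "'e set \<Rightarrow> ('e, 'o) realization pmf \<Rightarrow> ('g \<Rightarrow> ('e, 'o) utility) \<Rightarrow> 'g set \<Rightarrow> 'g set \<Rightarrow>
     nat \<Rightarrow> nat \<Rightarrow> ('g, 'e, 'o) policy \<Rightarrow> bool" where
  "optimal_policy E p f G M l k \<pi>o \<longleftrightarrow>
     (\<exists>S. S \<subseteq> E \<and> card S = l \<and> \<pi>o \<in> \<Omega> E p G S k) \<and>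
     (\<forall>S \<pi>. S \<subseteq> E \<and> card S = l \<and> \<pi> \<in> \<Omega> E p G S k \<longrightarrow>
        avg_utility p f M (selected E \<pi>) \<le> avg_utility p f M (selected E \<pi>o))"

section \<open>The two-phase randomized greedy policy\<close>

text \<open>
  The extended ground set is \<open>E <+> {..<k}\<close>: \<open>Inl e\<close> is the item \<open>e\<close> and \<open>Inr j\<close> the \<open>j\<close>-th dummy.
  The set of real items in \<open>X\<close> is \<open>Inl -` X\<close>.
\<close>

definition init_gain ::
    "('e, 'o) realization pmf \<Rightarrow> ('g \<Rightarrow> ('e, 'o) utility) \<Rightarrow> 'g set \<Rightarrow>
     ('e + nat) set \<Rightarrow> 'e + nat \<Rightarrow> real" where
  "init_gain p f M X x =
     (1 / real (card M)) *
       (\<Sum>i\<in>M. exp_utility p (f i) (Inl -` (X \<union> {x})) - exp_utility p (f i) (Inl -` X))"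

definition ext_marginal ::
    "('e, 'o) realization pmf \<Rightarrow> ('e, 'o) utility \<Rightarrow> ('e \<rightharpoonup> 'o) \<Rightarrow> 'e + nat \<Rightarrow> real" where
  "ext_marginal p u \<psi> x = (case x of Inl e \<Rightarrow> marginal p u \<psi> e | Inr j \<Rightarrow> 0)"

text \<open>\<open>T\<close> consists of \<open>n\<close> elements of \<open>A\<close> with the largest values of \<open>v\<close>.\<close>

definition top_set :: "('a \<Rightarrow> real) \<Rightarrow> 'a set \<Rightarrow> nat \<Rightarrow> 'a set \<Rightarrow> bool" where
  "top_set v A n T \<longleftrightarrow> T \<subseteq> A \<and> card T = n \<and> (\<forall>x\<in>T. \<forall>y\<in>A - T. v y \<le> v x)"

text \<open>
  The state of a run is the list of sampled extended items, latest first, of length equal to the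
  round number (an item or dummy may be sampled again, which has no effect). The candidate sets are
  given by functions \<open>U\<close> and \<open>V\<close>; as these may depend on the whole list, ties may be resolved
  differently in different rounds and histories.
\<close>

definition init_rule ::
    "'e set \<Rightarrow> ('e, 'o) realization pmf \<Rightarrow> ('g \<Rightarrow> ('e, 'o) utility) \<Rightarrow> 'g set \<Rightarrow> nat \<Rightarrow> nat \<Rightarrow>
     (('e + nat) list \<Rightarrow> ('e + nat) set) \<Rightarrow> bool" where
  "init_rule E p f M l k U \<longleftrightarrow>
     (\<forall>xs. set xs \<subseteq> E <+> {..<k} \<and> length xs < l \<longrightarrow>
        top_set (init_gain p f M (set xs)) (E <+> {..<k}) l (U xs))"

definition exec_rule ::
    "'e set \<Rightarrow> ('e, 'o) realization pmf \<Rightarrow> ('g \<Rightarrow> ('e, 'o) utility) \<Rightarrow> 'g set \<Rightarrow> nat \<Rightarrow> nat \<Rightarrow>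
     ('g \<Rightarrow> ('e + nat) list \<Rightarrow> ('e \<rightharpoonup> 'o) \<Rightarrow> ('e + nat) set) \<Rightarrow> bool" where
  "exec_rule E p f G l k V \<longleftrightarrow>
     (\<forall>i\<in>G. \<forall>xs \<psi>. set xs \<subseteq> E <+> {..<k} \<and> l \<le> length xs \<and> length xs < k \<and>
        partial_real E p \<psi> \<and> dom \<psi> = Inl -` set xs \<longrightarrow>
        top_set (ext_marginal p (f i) \<psi>) (E <+> {..<k}) (k - l) (V i xs \<psi>))"

primrec init_phase ::
    "(('e + nat) list \<Rightarrow> ('e + nat) set) \<Rightarrow> nat \<Rightarrow> ('e + nat) list pmf" where
  "init_phase U 0 = return_pmf []"
| "init_phase U (Suc t) =
     bind_pmf (init_phase U t) (\<lambda>xs. map_pmf (\<lambda>x. x # xs) (pmf_of_set (U xs)))"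

primrec exec_phase ::
    "(('e + nat) list \<Rightarrow> ('e \<rightharpoonup> 'o) \<Rightarrow> ('e + nat) set) \<Rightarrow> ('e, 'o) realization \<Rightarrow>
     ('e + nat) list \<Rightarrow> nat \<Rightarrow> ('e + nat) list pmf" where
  "exec_phase W \<phi> xs 0 = return_pmf xs"
| "exec_phase W \<phi> xs (Suc t) =
     bind_pmf (exec_phase W \<phi> xs t)
       (\<lambda>ys. map_pmf (\<lambda>y. y # ys) (pmf_of_set (W ys (observed \<phi> (Inl -` set ys)))))"

text \<open>
  The law of the set of (real) items selected for task \<open>i\<close> under \<open>\<phi>\<close>. The initial set is drawn
  without knowledge of the task or the realization.
\<close>

definition two_phase_greedy ::
    "(('e + nat) list \<Rightarrow> ('e + nat) set) \<Rightarrow>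
     ('g \<Rightarrow> ('e + nat) list \<Rightarrow> ('e \<rightharpoonup> 'o) \<Rightarrow> ('e + nat) set) \<Rightarrow>
     nat \<Rightarrow> nat \<Rightarrow> 'g \<Rightarrow> ('e, 'o) realization \<Rightarrow> 'e set pmf" where
  "two_phase_greedy U V l k i \<phi> =
     map_pmf (\<lambda>ys. Inl -` set ys)
       (bind_pmf (init_phase U l) (\<lambda>xs. exec_phase (V i) \<phi> xs (k - l)))"

end

theory Submission
  imports Defs
begin

text \<open>
  Write \<open>R\<close> for the initial set, \<open>P\<^sub>t\<close> for the items added in the first \<open>t\<close> of the \<open>K = k - l\<close>
  execution rounds, \<open>S\<close> for the initial set of the optimal policy and \<open>Y \<supseteq> S\<close> for all items it
  selects. All inequalities are in expectation and averaged over the tasks, and \<open>q = 1 - 1/K\<close>.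

  \<^item> Sampling from \<open>n\<close> candidates destroys at most a fraction \<open>1/n\<close> of any utility, because adding
    all candidates at once leaves it nonnegative and the sum of the single gains is at least the
    joint gain. Hence \<open>f(R \<union> P\<^sub>t \<union> Y) \<ge> q\<^sup>t (1 - 1/l)\<^sup>l f(Y)\<close>.
  \<^item> The at most \<open>K\<close> items of \<open>Y - S\<close> gain no more on top of \<open>R \<union> P\<^sub>t \<union> S\<close> than the best \<open>K\<close>
    marginals at \<open>R \<union> P\<^sub>t\<close>, that is, \<open>K\<close> times the gain of the next round.
  \<^item> Greedily chosen items have nonnegative marginals (there are enough dummies), so \<open>P\<^sub>t\<close> gains on top
    of \<open>R \<union> S\<close> at most what it gains on top of \<open>R\<close>:
    \<open>f(R \<union> P\<^sub>t \<union> S) \<le> f(R \<union> P\<^sub>t) - f(R) + f(R \<union> S)\<close>.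
  \<^item> The same comparison as in the second item for the \<open>l\<close> items of \<open>S\<close> in the initialization phase gives
    \<open>f(R \<union> S) - f(R) \<le> f(R) - f(\<emptyset>)\<close>.

  Together \<open>q\<^sup>t (1 - 1/l)\<^sup>l f(Y) \<le> K (f(R \<union> P\<^sub>t\<^sub>+\<^sub>1) - f(R \<union> P\<^sub>t)) + f(R \<union> P\<^sub>t) + f(R)\<close>; replacing
  \<open>q\<^sup>t\<close> by \<open>q\<^sup>K\<close> and \<open>f(R \<union> P\<^sub>t)\<close> by \<open>f(R \<union> P\<^sub>K)\<close> and summing over \<open>t < K\<close>, the gains telescope
  and leave \<open>q\<^sup>K (1 - 1/l)\<^sup>l f(Y) \<le> 2 f(R \<union> P\<^sub>K)\<close>.
\<close>

section \<open>Partial realizations\<close>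

lemma observed_eq_iff: "observed \<phi> A = observed \<phi>' A \<longleftrightarrow> (\<forall>x\<in>A. \<phi> x = \<phi>' x)"
  by (auto simp: observed_def restrict_map_def fun_eq_iff)

lemma dom_observed [simp]: "dom (observed \<phi> A) = A"
  by (auto simp: observed_def)

text \<open>For fixed \<open>A\<close> the conditioning events are equivalence classes of
  realizations, so they form a partition.\<close>

lemma agreeing_observed: "agreeing (observed \<phi> A) = {\<phi>'. observed \<phi> A = observed \<phi>' A}"
  by (auto simp: agreeing_def observed_eq_iff map_le_def) (auto simp: observed_def restrict_map_def)

lemma observed_mono: "A \<subseteq> B \<Longrightarrow> observed \<phi> A \<subseteq>\<^sub>m observed \<phi> B"
  by (auto simp: map_le_def observed_def)

lemma observed_eq_mono: "observed \<phi> B = observed \<phi>' B \<Longrightarrow> A \<subseteq> B \<Longrightarrow> observed \<phi> A = observed \<phi>' A"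
  by (auto simp: observed_eq_iff)

lemma agreeing_self: "\<phi> \<in> agreeing (observed \<phi> A)"
  by (simp add: agreeing_observed)

lemma set_pmf_agreeing_nonempty: "\<phi> \<in> set_pmf p \<Longrightarrow> set_pmf p \<inter> agreeing (observed \<phi> A) \<noteq> {}"
  using agreeing_self by blast

lemma partial_real_observed: "\<phi> \<in> set_pmf p \<Longrightarrow> A \<subseteq> E \<Longrightarrow> partial_real E p (observed \<phi> A)"
  using set_pmf_agreeing_nonempty
  by (auto simp: partial_real_def intro!: measure_measure_pmf_not_zero simp: zero_less_measure_iff)

section \<open>Conditioning on the observed states\<close>

text \<open>The tower property for distributions: redrawing \<open>\<phi>\<close> within its own
  class leaves the prior unchanged.\<close>

lemma bind_cond_agreeing: "bind_pmf p (\<lambda>\<phi>. cond_pmf p (agreeing (observed \<phi> B))) = p"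
  unfolding agreeing_observed
  by (rule bind_cond_pmf_cancel) (auto simp: eq_commute)

text \<open>The tower property for expectations. In \<open>ennreal\<close> the identity needs no
  integrability; finiteness of the total then yields integrability of \<open>c\<close> and of
  \<open>h\<close> under each conditional law.\<close>

lemma integral_cond_agreeing:
  fixes p :: "('e, 'o) realization pmf" and h :: "('e, 'o) realization \<Rightarrow> real" and B :: "'e set"
  defines "c \<equiv> \<lambda>\<phi>. measure_pmf.expectation (cond_pmf p (agreeing (observed \<phi> B))) h"
  assumes int: "integrable p h" and nn: "\<And>\<phi>. \<phi> \<in> set_pmf p \<Longrightarrow> 0 \<le> h \<phi>"
  shows "integrable p c" "measure_pmf.expectation p c = measure_pmf.expectation p h"
    "\<And>\<phi>. \<phi> \<in> set_pmf p \<Longrightarrow> integrable (cond_pmf p (agreeing (observed \<phi> B))) h"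
proof -
  let ?C = "\<lambda>\<phi>. cond_pmf p (agreeing (observed \<phi> B))"
  have nn': "AE \<phi>' in ?C \<phi>. 0 \<le> h \<phi>'" if "\<phi> \<in> set_pmf p" for \<phi>
    using that nn by (auto simp: AE_measure_pmf_iff set_cond_pmf[OF set_pmf_agreeing_nonempty])
  have "(\<integral>\<^sup>+\<phi>. h \<phi> \<partial>p) = (\<integral>\<^sup>+\<phi>. h \<phi> \<partial>(bind_pmf p ?C))"
    by (simp only: bind_cond_agreeing)
  then have eq: "(\<integral>\<^sup>+\<phi>. h \<phi> \<partial>p) = (\<integral>\<^sup>+\<phi>. (\<integral>\<^sup>+\<phi>'. h \<phi>' \<partial>?C \<phi>) \<partial>p)"
    by simp
  have fin: "(\<integral>\<^sup>+\<phi>. h \<phi> \<partial>p) < \<infinity>"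
    using int nn by (subst nn_integral_eq_integral) (auto simp: AE_measure_pmf_iff)
  then have "AE \<phi> in p. (\<integral>\<^sup>+\<phi>'. h \<phi>' \<partial>?C \<phi>) \<noteq> \<infinity>"
    unfolding eq by (intro nn_integral_noteq_infinite) auto
  \<comment> \<open>As \<open>p\<close> is discrete, almost everywhere means everywhere on its
    support.\<close>
  then have inner: "(\<integral>\<^sup>+\<phi>'. h \<phi>' \<partial>?C \<phi>) < \<infinity>" if "\<phi> \<in> set_pmf p" for \<phi>
    using that by (auto simp: AE_measure_pmf_iff less_top)
  show intC: "integrable (?C \<phi>) h" if "\<phi> \<in> set_pmf p" for \<phi>
    using that inner nn' by (intro integrableI_nonneg) auto
  have c_eq: "ennreal (c \<phi>) = (\<integral>\<^sup>+\<phi>'. h \<phi>' \<partial>?C \<phi>)" if "\<phi> \<in> set_pmf p" for \<phi>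
    unfolding c_def using that intC nn' by (subst nn_integral_eq_integral) auto
  have c_nn: "AE \<phi> in p. 0 \<le> c \<phi>"
    unfolding c_def AE_measure_pmf_iff using nn' by (auto intro!: integral_nonneg_AE)
  have eq': "(\<integral>\<^sup>+\<phi>. c \<phi> \<partial>p) = (\<integral>\<^sup>+\<phi>. h \<phi> \<partial>p)"
    unfolding eq by (intro nn_integral_cong_AE) (auto simp: AE_measure_pmf_iff c_eq)
  show int_c: "integrable p c"
    using fin eq' c_nn by (intro integrableI_nonneg) auto
  have "ennreal (measure_pmf.expectation p c) = ennreal (measure_pmf.expectation p h)"
    using eq' int_c c_nn int nn by (simp add: nn_integral_eq_integral AE_measure_pmf_iff)
  then show "measure_pmf.expectation p c = measure_pmf.expectation p h"
    using c_nn nn by (simp add: integral_nonneg_AE AE_measure_pmf_iff)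
qed

text \<open>
  Weights are the probabilities with which an adaptive procedure reaches a given history: they may
  depend on the realization only through the states of the items observed on that history.
\<close>

definition weight :: "('e, 'o) realization pmf \<Rightarrow> 'e set \<Rightarrow> (('e, 'o) realization \<Rightarrow> real) \<Rightarrow> bool" where
  "weight p B w \<longleftrightarrow> (\<forall>\<phi>\<in>set_pmf p. 0 \<le> w \<phi> \<and> w \<phi> \<le> 1) \<and>
     (\<forall>\<phi>\<in>set_pmf p. \<forall>\<phi>'\<in>set_pmf p. observed \<phi> B = observed \<phi>' B \<longrightarrow> w \<phi> = w \<phi>')"

lemma weightI:
  assumes "\<And>\<phi>. \<phi> \<in> set_pmf p \<Longrightarrow> 0 \<le> w \<phi>" "\<And>\<phi>. \<phi> \<in> set_pmf p \<Longrightarrow> w \<phi> \<le> 1"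
    "\<And>\<phi> \<phi>'. \<phi> \<in> set_pmf p \<Longrightarrow> \<phi>' \<in> set_pmf p \<Longrightarrow> observed \<phi> B = observed \<phi>' B \<Longrightarrow> w \<phi> = w \<phi>'"
  shows "weight p B w"
  unfolding weight_def using assms by blast

lemma weight_bounds: "weight p B w \<Longrightarrow> \<phi> \<in> set_pmf p \<Longrightarrow> 0 \<le> w \<phi> \<and> w \<phi> \<le> 1"
  unfolding weight_def by blast

lemma weight_nonneg: "weight p B w \<Longrightarrow> \<phi> \<in> set_pmf p \<Longrightarrow> 0 \<le> w \<phi>"
  unfolding weight_def by blast

lemma weight_cong:
  "weight p B w \<Longrightarrow> \<phi> \<in> set_pmf p \<Longrightarrow> \<phi>' \<in> set_pmf p \<Longrightarrow> observed \<phi> B = observed \<phi>' B \<Longrightarrow> w \<phi> = w \<phi>'"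
  unfolding weight_def by blast

lemma weight_one [simp]: "weight p B (\<lambda>_. 1)"
  by (simp add: weight_def)

lemma weight_mono: "weight p A w \<Longrightarrow> A \<subseteq> B \<Longrightarrow> weight p B w"
  unfolding weight_def by (metis observed_eq_mono)

lemma weight_mult:
  assumes "weight p A v" "weight p B w" "A \<subseteq> C" "B \<subseteq> C"
  shows "weight p C (\<lambda>\<phi>. v \<phi> * w \<phi>)"
proof (rule weightI)
  fix \<phi> \<phi>' assume "\<phi> \<in> set_pmf p" "\<phi>' \<in> set_pmf p" "observed \<phi> C = observed \<phi>' C"
  then have "v \<phi> = v \<phi>'" "w \<phi> = w \<phi>'"
    using weight_cong[OF assms(1)] weight_cong[OF assms(2)] observed_eq_mono assms(3,4) by metis+
  then show "v \<phi> * w \<phi> = v \<phi>' * w \<phi>'" by (rule arg_cong2)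
qed (use weight_bounds[OF assms(1)] weight_bounds[OF assms(2)] in \<open>auto intro: mult_le_one\<close>)

lemma weight_observed:
  "(\<And>\<psi>. 0 \<le> h \<psi> \<and> h \<psi> \<le> 1) \<Longrightarrow> weight p B (\<lambda>\<phi>. h (observed \<phi> B))"
  by (simp add: weight_def)

lemma integrable_mult_bounded:
  fixes w h :: "'a \<Rightarrow> real"
  assumes "integrable (measure_pmf p) h" "\<And>\<phi>. \<phi> \<in> set_pmf p \<Longrightarrow> 0 \<le> w \<phi> \<and> w \<phi> \<le> 1"
  shows "integrable (measure_pmf p) (\<lambda>\<phi>. w \<phi> * h \<phi>)"
proof (rule Bochner_Integration.integrable_bound[OF assms(1)])
  show "AE \<phi> in p. norm (w \<phi> * h \<phi>) \<le> norm (h \<phi>)"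
    using assms(2) by (auto simp: AE_measure_pmf_iff abs_mult intro!: mult_left_le_one_le)
qed simp

lemma integrable_weight_mult:
  "weight p B w \<Longrightarrow> integrable p h \<Longrightarrow> integrable p (\<lambda>\<phi>. w \<phi> * h \<phi>)"
  by (rule integrable_mult_bounded) (auto simp: weight_bounds)

text \<open>What is known can be taken out: \<open>w\<close> is constant on each class, so it moves
  inside the conditional expectation and the tower property applies to the product.\<close>

lemma integral_weight_cond:
  fixes p :: "('e, 'o) realization pmf" and h :: "('e, 'o) realization \<Rightarrow> real" and B :: "'e set"
  defines "c \<equiv> \<lambda>\<phi>. measure_pmf.expectation (cond_pmf p (agreeing (observed \<phi> B))) h"
  assumes int: "integrable p h" and nn: "\<And>\<phi>. \<phi> \<in> set_pmf p \<Longrightarrow> 0 \<le> h \<phi>" and w: "weight p B w"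
  shows "measure_pmf.expectation p (\<lambda>\<phi>. w \<phi> * c \<phi>) = measure_pmf.expectation p (\<lambda>\<phi>. w \<phi> * h \<phi>)"
proof -
  have "measure_pmf.expectation p (\<lambda>\<phi>. w \<phi> * c \<phi>) =
     measure_pmf.expectation p
       (\<lambda>\<phi>. measure_pmf.expectation (cond_pmf p (agreeing (observed \<phi> B))) (\<lambda>\<phi>'. w \<phi>' * h \<phi>'))"
  proof (intro integral_cong_AE)
    show "AE \<phi> in p. w \<phi> * c \<phi> =
        measure_pmf.expectation (cond_pmf p (agreeing (observed \<phi> B))) (\<lambda>\<phi>'. w \<phi>' * h \<phi>')"
      unfolding AE_measure_pmf_iff
    proof
      fix \<phi> assume \<phi>: "\<phi> \<in> set_pmf p"
      have "AE \<phi>' in cond_pmf p (agreeing (observed \<phi> B)). w \<phi> * h \<phi>' = w \<phi>' * h \<phi>'"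
        unfolding AE_measure_pmf_iff set_cond_pmf[OF set_pmf_agreeing_nonempty[OF \<phi>]]
        by (intro ballI arg_cong2[where f = "(*)"] weight_cong[OF w \<phi>] refl)
          (simp_all add: agreeing_observed)
      then have "measure_pmf.expectation (cond_pmf p (agreeing (observed \<phi> B))) (\<lambda>\<phi>'. w \<phi> * h \<phi>') =
          measure_pmf.expectation (cond_pmf p (agreeing (observed \<phi> B))) (\<lambda>\<phi>'. w \<phi>' * h \<phi>')"
        by (intro integral_cong_AE) auto
      then show "w \<phi> * c \<phi> =
          measure_pmf.expectation (cond_pmf p (agreeing (observed \<phi> B))) (\<lambda>\<phi>'. w \<phi>' * h \<phi>')"
        by (simp add: c_def)
    qed
  qed auto
  also have "\<dots> = measure_pmf.expectation p (\<lambda>\<phi>. w \<phi> * h \<phi>)"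
    using nn w by (intro integral_cond_agreeing integrable_weight_mult[OF w int])
      (auto simp: weight_nonneg)
  finally show ?thesis .
qed

lemma integral_mono_pmf:
  fixes g h :: "'a \<Rightarrow> real"
  assumes "integrable (measure_pmf p) g" "integrable (measure_pmf p) h"
    "\<And>x. x \<in> set_pmf p \<Longrightarrow> g x \<le> h x"
  shows "measure_pmf.expectation p g \<le> measure_pmf.expectation p h"
  using assms by (intro integral_mono_AE) (auto simp: AE_measure_pmf_iff)

lemma integral_cong_pmf:
  fixes g h :: "'a \<Rightarrow> real"
  assumes "\<And>x. x \<in> set_pmf p \<Longrightarrow> g x = h x"
  shows "measure_pmf.expectation p g = measure_pmf.expectation p h"
  using assms by (intro integral_cong_AE) (auto simp: AE_measure_pmf_iff)

section \<open>Weighted expected utilities of one task\<close>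

locale adaptive_submodular_utility =
  fixes E :: "'e set" and p :: "('e, 'o) realization pmf" and u :: "('e, 'o) utility"
  assumes finite_E: "finite E"
    and nonneg: "\<And>Y \<phi>. Y \<subseteq> E \<Longrightarrow> \<phi> \<in> set_pmf p \<Longrightarrow> 0 \<le> u Y \<phi>"
    and integrable_u: "\<And>Y. Y \<subseteq> E \<Longrightarrow> integrable p (u Y)"
    and adaptive_submodular: "adaptive_submodular E p u"
begin

text \<open>With \<open>w\<close> the probability of reaching a history, this is the share of that
  history in the expected utility. Inequalities for fixed sets and arbitrary weights can then be
  summed over histories.\<close>

definition wu :: "(('e, 'o) realization \<Rightarrow> real) \<Rightarrow> 'e set \<Rightarrow> real" where
  "wu w Y = measure_pmf.expectation p (\<lambda>\<phi>. w \<phi> * u Y \<phi>)"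

lemma integrable_wu: "weight p B w \<Longrightarrow> Y \<subseteq> E \<Longrightarrow> integrable p (\<lambda>\<phi>. w \<phi> * u Y \<phi>)"
  by (intro integrable_weight_mult integrable_u)

lemma wu_nonneg: "weight p B w \<Longrightarrow> Y \<subseteq> E \<Longrightarrow> 0 \<le> wu w Y"
  unfolding wu_def using nonneg
  by (intro integral_nonneg_AE) (auto simp: AE_measure_pmf_iff weight_nonneg)

lemma marginal_eq_diff:
  assumes "B \<subseteq> E" "e \<in> E" "\<phi> \<in> set_pmf p"
  shows "marginal p u (observed \<phi> B) e =
    measure_pmf.expectation (cond_pmf p (agreeing (observed \<phi> B))) (u (insert e B)) -
    measure_pmf.expectation (cond_pmf p (agreeing (observed \<phi> B))) (u B)"
  unfolding marginal_def using assms nonneg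
  by (simp, intro Bochner_Integration.integral_diff integral_cond_agreeing(3) integrable_u) auto

lemma integrable_marginal:
  assumes "B \<subseteq> E" "e \<in> E"
  shows "integrable p (\<lambda>\<phi>. marginal p u (observed \<phi> B) e)"
proof -
  let ?c = "\<lambda>Y \<phi>. measure_pmf.expectation (cond_pmf p (agreeing (observed \<phi> B))) (u Y)"
  have "integrable p (\<lambda>\<phi>. ?c (insert e B) \<phi> - ?c B \<phi>)"
    using assms nonneg by (intro Bochner_Integration.integrable_diff integral_cond_agreeing(1)
        integrable_u) auto
  moreover have "AE \<phi> in p. ?c (insert e B) \<phi> - ?c B \<phi> = marginal p u (observed \<phi> B) e"
    using assms by (auto simp: AE_measure_pmf_iff marginal_eq_diff)
  ultimately show ?thesis
    by (subst integrable_cong_AE[symmetric]) auto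
qed

lemma wu_insert:
  assumes "weight p B w" "B \<subseteq> E" "e \<in> E"
  shows "wu w (insert e B) - wu w B =
    measure_pmf.expectation p (\<lambda>\<phi>. w \<phi> * marginal p u (observed \<phi> B) e)"
proof -
  let ?c = "\<lambda>Y \<phi>. measure_pmf.expectation (cond_pmf p (agreeing (observed \<phi> B))) (u Y)"
  have c: "wu w Y = measure_pmf.expectation p (\<lambda>\<phi>. w \<phi> * ?c Y \<phi>)" if "Y \<subseteq> E" for Y
    unfolding wu_def
    by (rule integral_weight_cond[OF integrable_u[OF that] nonneg[OF that] assms(1), symmetric])
  have int: "integrable p (\<lambda>\<phi>. w \<phi> * ?c Y \<phi>)" if "Y \<subseteq> E" for Y
    by (intro integrable_weight_mult[OF assms(1)] integral_cond_agreeing(1) integrable_u nonneg that)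
  have "wu w (insert e B) - wu w B =
    measure_pmf.expectation p (\<lambda>\<phi>. w \<phi> * ?c (insert e B) \<phi> - w \<phi> * ?c B \<phi>)"
    using assms by (subst Bochner_Integration.integral_diff) (auto simp: c intro!: int)
  also have "\<dots> = measure_pmf.expectation p (\<lambda>\<phi>. w \<phi> * marginal p u (observed \<phi> B) e)"
    using assms by (intro integral_cong_pmf) (simp add: marginal_eq_diff right_diff_distrib)
  finally show ?thesis .
qed

lemma marginal_antimono:
  assumes "A \<subseteq> B" "B \<subseteq> E" "e \<in> E - B" "\<phi> \<in> set_pmf p"
  shows "marginal p u (observed \<phi> B) e \<le> marginal p u (observed \<phi> A) e"
proof -
  have "partial_real E p (observed \<phi> A)" "partial_real E p (observed \<phi> B)"
    using assms by (auto intro!: partial_real_observed)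
  then show ?thesis
    using adaptive_submodular assms(3) observed_mono[OF assms(1), of \<phi>]
    unfolding adaptive_submodular_def by auto
qed

text \<open>Adaptive submodularity is applied pointwise in \<open>\<phi>\<close>. Since
  \<open>w\<close> may depend on all of \<open>B\<close>, the right side is in general no difference
  of \<open>wu\<close> at \<open>A\<close>; that form, in \<open>wu_insert_antimono\<close>, takes a
  weight determined by \<open>A\<close>.\<close>

lemma wu_insert_le:
  assumes "A \<subseteq> B" "B \<subseteq> E" "e \<in> E - B" "weight p B w"
  shows "wu w (insert e B) - wu w B \<le>
    measure_pmf.expectation p (\<lambda>\<phi>. w \<phi> * marginal p u (observed \<phi> A) e)"
proof -
  have "wu w (insert e B) - wu w B =
    measure_pmf.expectation p (\<lambda>\<phi>. w \<phi> * marginal p u (observed \<phi> B) e)"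
    using assms by (intro wu_insert) auto
  also have "\<dots> \<le> measure_pmf.expectation p (\<lambda>\<phi>. w \<phi> * marginal p u (observed \<phi> A) e)"
    using assms
    by (intro integral_mono_pmf integrable_weight_mult integrable_marginal mult_left_mono
        marginal_antimono) (auto simp: weight_nonneg)
  finally show ?thesis .
qed

lemma wu_insert_antimono:
  assumes "A \<subseteq> B" "B \<subseteq> E" "e \<in> E - B" "weight p A w"
  shows "wu w (insert e B) - wu w B \<le> wu w (insert e A) - wu w A"
proof -
  have "wu w (insert e A) - wu w A =
    measure_pmf.expectation p (\<lambda>\<phi>. w \<phi> * marginal p u (observed \<phi> A) e)"
    using assms by (intro wu_insert) auto
  then show ?thesis
    using wu_insert_le[OF assms(1-3) weight_mono[OF assms(4,1)]] by simp
qed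

lemma wu_union_le:
  assumes "weight p B w" "B \<subseteq> E" "finite T" "T \<subseteq> E <+> UNIV"
  shows "wu w (B \<union> Inl -` T) - wu w B \<le> (\<Sum>y\<in>T. wu w (B \<union> Inl -` {y}) - wu w B)"
  using assms(3,4)
proof (induction T)
  case (insert y T)
  let ?BT = "B \<union> Inl -` T"
  have IH: "wu w ?BT - wu w B \<le> (\<Sum>y\<in>T. wu w (B \<union> Inl -` {y}) - wu w B)"
    using insert by auto
  have "wu w (B \<union> Inl -` insert y T) - wu w ?BT \<le> wu w (B \<union> Inl -` {y}) - wu w B"
  proof (cases y)
    case (Inl e)
    have sets: "B \<union> Inl -` insert y T = insert e ?BT" "B \<union> Inl -` {y} = insert e B"
      using Inl by auto
    show ?thesis
    proof (cases "e \<in> ?BT")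
      \<comment> \<open>As \<open>y\<close> is new to \<open>T\<close>, the item lies in
        \<open>B\<close> already and both gains vanish.\<close>
      case True
      with Inl \<open>y \<notin> T\<close> have "insert e ?BT = ?BT" "insert e B = B" by auto
      then show ?thesis unfolding sets by simp
    next
      case False
      then show ?thesis
        unfolding sets using insert.prems assms Inl by (intro wu_insert_antimono) auto
    qed
  next
    case (Inr j)
    then have "B \<union> Inl -` insert y T = ?BT" "B \<union> Inl -` {y} = B" by auto
    then show ?thesis by simp
  qed
  then show ?case using IH insert by simp
qed simp

text \<open>The bound on the damage done by sampling: by nonnegativity the joint gain of
  \<open>T\<close> is at least \<open>- wu w B\<close>, and it is at most the sum of the single
  gains. Hence a uniform choice from a nonempty \<open>T\<close> keeps the fraction
  \<open>1 - 1 / card T\<close> on average.\<close>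

lemma wu_sum_ge:
  assumes "weight p B w" "B \<subseteq> E" "finite T" "T \<subseteq> E <+> UNIV"
  shows "(real (card T) - 1) * wu w B \<le> (\<Sum>y\<in>T. wu w (B \<union> Inl -` {y}))"
proof -
  have "0 \<le> wu w (B \<union> Inl -` T)" using assms by (intro wu_nonneg) auto
  then show ?thesis
    using wu_union_le[OF assms] by (simp add: sum_subtractf algebra_simps)
qed

end

section \<open>Sets of largest values\<close>

text \<open>Pigeonhole: \<open>T\<close> misses some element of \<open>D\<close>, and all of
  \<open>T\<close> dominates that element. Later \<open>D\<close> consists of the dummies.\<close>

lemma top_set_nonneg:
  assumes "top_set v A n T" "finite A" "D \<subseteq> A" "n < card D" "\<And>x. x \<in> D \<Longrightarrow> 0 \<le> v x" "x \<in> T"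
  shows "0 \<le> v x"
proof -
  have T: "T \<subseteq> A" "card T = n" using assms(1) by (auto simp: top_set_def)
  then have "finite T" using assms(2) finite_subset by blast
  then have "\<not> D \<subseteq> T" using card_mono[of T D] T assms(4) by auto
  then obtain d where "d \<in> D" "d \<notin> T" by blast
  then have "v d \<le> v x" using assms(1,3,6) by (auto simp: top_set_def)
  then show ?thesis using assms(5)[OF \<open>d \<in> D\<close>] by simp
qed

text \<open>Exchange argument: common elements cancel, \<open>S - T\<close> is no larger than
  \<open>T - S\<close>, and each of its elements is dominated by each element of
  \<open>T - S\<close>.\<close>

lemma top_set_sum_ge:
  assumes top: "top_set v A n T" and "finite A" and nn: "\<And>x. x \<in> T \<Longrightarrow> 0 \<le> v x"
    and "S \<subseteq> A" "card S \<le> n"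
  shows "(\<Sum>x\<in>S. max 0 (v x)) \<le> (\<Sum>x\<in>T. v x)"
proof -
  have T: "T \<subseteq> A" "card T = n" using top by (auto simp: top_set_def)
  then have fin: "finite T" "finite S" using \<open>finite A\<close> \<open>S \<subseteq> A\<close> finite_subset by blast+
  have card: "card (S - T) \<le> card (T - S)"
    using card_Diff_subset_Int[of S T] card_Diff_subset_Int[of T S] fin T \<open>card S \<le> n\<close>
    by (simp add: Int_commute)
  have rest: "(\<Sum>x\<in>S - T. max 0 (v x)) \<le> (\<Sum>x\<in>T - S. v x)"
  proof (cases "T - S = {}")
    case True
    have "card (S - T) = 0" using card unfolding True by simp
    then have "S - T = {}" using fin by simp
    then show ?thesis using True by simp
  next
    case False
    \<comment> \<open>A threshold between the two differences: an upper bound for the truncated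
      values on \<open>S - T\<close> and a lower bound for the values on
      \<open>T - S\<close>.\<close>
    define c where "c = Min (v ` (T - S))"
    have c: "c \<in> v ` (T - S)" unfolding c_def using False fin by (intro Min_in) auto
    have "max 0 (v x) \<le> c" if "x \<in> S - T" for x
      using that c top nn \<open>S \<subseteq> A\<close> by (auto simp: top_set_def)
    then have "(\<Sum>x\<in>S - T. max 0 (v x)) \<le> real (card (S - T)) * c"
      by (rule sum_bounded_above)
    also have "\<dots> \<le> real (card (T - S)) * c"
      using card c nn by (intro mult_right_mono) auto
    also have "\<dots> \<le> (\<Sum>x\<in>T - S. v x)"
      unfolding c_def using fin by (intro sum_bounded_below Min_le) auto
    finally show ?thesis .
  qed
  have "(\<Sum>x\<in>S. max 0 (v x)) = (\<Sum>x\<in>S - T. max 0 (v x)) + (\<Sum>x\<in>S \<inter> T. max 0 (v x))"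
    using fin by (subst sum.union_disjoint[symmetric]) (auto intro!: sum.cong)
  also have "(\<Sum>x\<in>S \<inter> T. max 0 (v x)) = (\<Sum>x\<in>S \<inter> T. v x)"
    using nn by (intro sum.cong) auto
  also have "(\<Sum>x\<in>S - T. max 0 (v x)) + \<dots> \<le> (\<Sum>x\<in>T - S. v x) + (\<Sum>x\<in>S \<inter> T. v x)"
    using rest by simp
  also have "\<dots> = (\<Sum>x\<in>T. v x)"
    using fin by (subst sum.union_disjoint[symmetric]) (auto intro!: sum.cong)
  finally show ?thesis .
qed

section \<open>Runs of adaptive policies\<close>

lemma run_policy_mono: "Y \<in> set_pmf (run_policy \<sigma> \<phi> n Z) \<Longrightarrow> Z \<subseteq> Y"
proof (induction n arbitrary: Z)
  case (Suc n)
  then obtain d where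
    "Y \<in> set_pmf (case d of None \<Rightarrow> return_pmf Z | Some e \<Rightarrow> run_policy \<sigma> \<phi> n (insert e Z))"
    by auto
  then show ?case using Suc.IH by (cases d) auto
qed simp

text \<open>While \<open>S\<close> is incomplete the policy can neither stop nor leave
  \<open>S\<close>, so each step lowers \<open>card (S - Z)\<close>.\<close>

lemma run_policy_superset:
  assumes "\<And>A. A \<subset> S \<Longrightarrow> set_pmf (\<sigma> (observed \<phi> A)) \<subseteq> Some ` (S - A)"
    and "finite S" "Z \<subseteq> S" "card (S - Z) \<le> n" "Y \<in> set_pmf (run_policy \<sigma> \<phi> n Z)"
  shows "S \<subseteq> Y"
  using assms(3-)
proof (induction n arbitrary: Z)
  case 0
  then show ?case using \<open>finite S\<close> by auto
next
  case (Suc n)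
  show ?case
  proof (cases "Z = S")
    case True
    then show ?thesis using run_policy_mono Suc.prems(3) by blast
  next
    case False
    then have *: "set_pmf (\<sigma> (observed \<phi> Z)) \<subseteq> Some ` (S - Z)"
      using assms(1) Suc.prems(1) by blast
    then obtain e where e: "e \<in> S - Z" "Y \<in> set_pmf (run_policy \<sigma> \<phi> n (insert e Z))"
      using Suc.prems(3) by auto
    have "card (S - insert e Z) \<le> n"
      using e Suc.prems(2) \<open>finite S\<close> card_Diff_singleton[of e "S - Z"]
      by (simp add: Diff_insert[of S e Z])
    then show ?thesis using e Suc.prems(1) by (intro Suc.IH) auto
  qed
qed

text \<open>Selected sets only grow, so a run ending in \<open>Y\<close> has used no state outside
  \<open>Y\<close> in any decision. This makes the probability of ending in \<open>Y\<close> a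
  weight on \<open>Y\<close>.\<close>

lemma pmf_run_policy_cong:
  assumes "observed \<phi> Y = observed \<phi>' Y"
  shows "pmf (run_policy \<sigma> \<phi> n Z) Y = pmf (run_policy \<sigma> \<phi>' n Z) Y"
proof (induction n arbitrary: Z)
  case (Suc n)
  show ?case
  proof (cases "Z \<subseteq> Y")
    case True
    then have "observed \<phi> Z = observed \<phi>' Z" using assms observed_eq_mono by metis
    then show ?thesis
      unfolding run_policy.simps pmf_bind
      by (intro Bochner_Integration.integral_cong) (auto split: option.splits simp: Suc.IH)
  next
    case False
    then have "Y \<notin> set_pmf (run_policy \<sigma> \<phi> (Suc n) Z)" "Y \<notin> set_pmf (run_policy \<sigma> \<phi>' (Suc n) Z)"
      using run_policy_mono by blast+
    then show ?thesis by (metis pmf_eq_0_set_pmf)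
  qed
qed simp

section \<open>Expectations over the runs of one policy\<close>

locale admissible_policy =
  fixes E :: "'e set" and p :: "('e, 'o) realization pmf" and \<sigma> :: "('e \<rightharpoonup> 'o) \<Rightarrow> 'e option pmf"
  assumes finite_E: "finite E"
    and choice: "\<And>\<phi> A. \<phi> \<in> set_pmf p \<Longrightarrow> A \<subseteq> E \<Longrightarrow>
      set_pmf (\<sigma> (observed \<phi> A)) \<subseteq> insert None (Some ` (E - A))"
begin

lemma run_policy_subset:
  assumes "\<phi> \<in> set_pmf p" "Z \<subseteq> E" "Y \<in> set_pmf (run_policy \<sigma> \<phi> n Z)"
  shows "Y \<subseteq> E"
  using assms(2,3)
proof (induction n arbitrary: Z)
  case (Suc n)
  then obtain d where d: "d \<in> set_pmf (\<sigma> (observed \<phi> Z))"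
    "Y \<in> set_pmf (case d of None \<Rightarrow> return_pmf Z | Some e \<Rightarrow> run_policy \<sigma> \<phi> n (insert e Z))"
    by auto
  then have "d = None \<or> (\<exists>e\<in>E. d = Some e)"
    using choice[OF assms(1) Suc.prems(1)] by auto
  then show ?case
  proof
    assume "\<exists>e\<in>E. d = Some e"
    then obtain e where "e \<in> E" "Y \<in> set_pmf (run_policy \<sigma> \<phi> n (insert e Z))"
      using d(2) by auto
    then show ?thesis using Suc.prems(1) by (intro Suc.IH[of "insert e Z"]) auto
  qed (use d(2) Suc.prems(1) in simp)
qed simp

text \<open>Replaces the random selected set by fixed sets \<open>Y\<close>, so that expectations
  over \<open>p\<close> can be taken term by term.\<close>

lemma run_policy_expectation:
  fixes g :: "'e set \<Rightarrow> real"
  assumes "\<phi> \<in> set_pmf p" "Z \<subseteq> E"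
  shows "measure_pmf.expectation (run_policy \<sigma> \<phi> n Z) g =
    (\<Sum>Y\<in>Pow E. pmf (run_policy \<sigma> \<phi> n Z) Y * g Y)"
  using run_policy_subset[OF assms] finite_E
  by (subst integral_measure_pmf_real[where A = "Pow E"]) (auto simp: mult.commute)

lemma run_policy_Suc_expectation:
  fixes g :: "'e set \<Rightarrow> real"
  assumes "\<phi> \<in> set_pmf p" "Z \<subseteq> E"
  shows "measure_pmf.expectation (run_policy \<sigma> \<phi> (Suc n) Z) g =
    pmf (\<sigma> (observed \<phi> Z)) None * g Z +
    (\<Sum>e\<in>E - Z. pmf (\<sigma> (observed \<phi> Z)) (Some e) *
       measure_pmf.expectation (run_policy \<sigma> \<phi> n (insert e Z)) g)"
proof -
  have fin: "finite (set_pmf (run_policy \<sigma> \<phi> n (insert e Z)))" if "e \<in> E" for e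
  proof (rule finite_subset)
    show "set_pmf (run_policy \<sigma> \<phi> n (insert e Z)) \<subseteq> Pow E"
      using run_policy_subset[OF assms(1), of "insert e Z"] assms(2) that by blast
  qed (use finite_E in simp)
  have "measure_pmf.expectation (run_policy \<sigma> \<phi> (Suc n) Z) g =
    (\<Sum>d\<in>insert None (Some ` (E - Z)). pmf (\<sigma> (observed \<phi> Z)) d *\<^sub>R
       measure_pmf.expectation
         (case d of None \<Rightarrow> return_pmf Z | Some e \<Rightarrow> run_policy \<sigma> \<phi> n (insert e Z)) g)"
    unfolding run_policy.simps
  proof (rule pmf_expectation_bind)
    show "set_pmf (\<sigma> (observed \<phi> Z)) \<subseteq> insert None (Some ` (E - Z))"
      by (rule choice[OF assms])
  qed (use finite_E fin in auto)
  also have "\<dots> = pmf (\<sigma> (observed \<phi> Z)) None * g Z +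
    (\<Sum>e\<in>E - Z. pmf (\<sigma> (observed \<phi> Z)) (Some e) *
       measure_pmf.expectation (run_policy \<sigma> \<phi> n (insert e Z)) g)"
    using finite_E by (subst sum.insert) (auto simp: sum.reindex)
  finally show ?thesis .
qed

lemma sum_choice:
  assumes "\<phi> \<in> set_pmf p" "Z \<subseteq> E"
  shows "pmf (\<sigma> (observed \<phi> Z)) None + (\<Sum>e\<in>E - Z. pmf (\<sigma> (observed \<phi> Z)) (Some e)) = 1"
proof -
  have "(\<Sum>d\<in>insert None (Some ` (E - Z)). pmf (\<sigma> (observed \<phi> Z)) d) = 1"
    using choice[OF assms] finite_E by (intro sum_pmf_eq_1) auto
  then show ?thesis using finite_E by (subst (asm) sum.insert) (auto simp: sum.reindex)
qed

lemma integrable_run_policy: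
  fixes g :: "'e set \<Rightarrow> ('e, 'o) realization \<Rightarrow> real"
  assumes "\<And>Y. Y \<subseteq> E \<Longrightarrow> integrable p (g Y)" "Z \<subseteq> E"
  shows "integrable p (\<lambda>\<phi>. measure_pmf.expectation (run_policy \<sigma> \<phi> n Z) (\<lambda>Y. g Y \<phi>))"
proof -
  have "integrable p (\<lambda>\<phi>. \<Sum>Y\<in>Pow E. pmf (run_policy \<sigma> \<phi> n Z) Y * g Y \<phi>)"
    using assms(1) by (intro Bochner_Integration.integrable_sum integrable_mult_bounded)
      (auto simp: pmf_le_1)
  then show ?thesis
    by (rule integrable_cong_AE_imp)
      (auto simp: AE_measure_pmf_iff run_policy_expectation assms(2))
qed

text \<open>An optional stopping argument. Since \<open>step\<close> is required for every weight on
  the known items, it acts as a conditional inequality: given what is known, selecting any fixed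
  item does not increase \<open>g\<close>. The set \<open>B\<close> holds information beyond the
  policy's own observations.\<close>

lemma run_policy_supermartingale:
  fixes g :: "'e set \<Rightarrow> ('e, 'o) realization \<Rightarrow> real"
  assumes int: "\<And>Y. Y \<subseteq> E \<Longrightarrow> integrable p (g Y)"
    and step: "\<And>w Z e. weight p (B \<union> Z) w \<Longrightarrow> Z \<subseteq> E \<Longrightarrow> e \<in> E - Z \<Longrightarrow>
      measure_pmf.expectation p (\<lambda>\<phi>. w \<phi> * g (insert e Z) \<phi>) \<le>
      measure_pmf.expectation p (\<lambda>\<phi>. w \<phi> * g Z \<phi>)"
    and "weight p (B \<union> Z) w" "Z \<subseteq> E"
  shows "measure_pmf.expectation p
      (\<lambda>\<phi>. w \<phi> * measure_pmf.expectation (run_policy \<sigma> \<phi> n Z) (\<lambda>Y. g Y \<phi>)) \<le>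
    measure_pmf.expectation p (\<lambda>\<phi>. w \<phi> * g Z \<phi>)"
  using assms(3,4)
proof (induction n arbitrary: Z w)
  case (Suc n)
  let ?r = "\<lambda>e \<phi>. measure_pmf.expectation (run_policy \<sigma> \<phi> n (insert e Z)) (\<lambda>Y. g Y \<phi>)"
  \<comment> \<open>The probability of decision \<open>d\<close> is absorbed into the weight. It
    depends only on the states on \<open>Z\<close>, so \<open>v d\<close> is again a weight on
    \<open>B \<union> Z\<close>.\<close>
  define v where "v d \<phi> = w \<phi> * pmf (\<sigma> (observed \<phi> Z)) d" for d \<phi>
  have v: "weight p (B \<union> Z) (v d)" for d
    unfolding v_def
    by (rule weight_mult[OF Suc.prems(1) weight_observed[of "\<lambda>\<psi>. pmf (\<sigma> \<psi>) d" p Z]])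
      (auto simp: pmf_le_1)
  have int_r: "integrable p (\<lambda>\<phi>. v (Some e) \<phi> * ?r e \<phi>)" if "e \<in> E - Z" for e
    using that Suc.prems(2) by (intro integrable_weight_mult[OF v] integrable_run_policy int) auto
  have int_g: "integrable p (\<lambda>\<phi>. v d \<phi> * g Z \<phi>)" for d
    by (rule integrable_weight_mult[OF v int[OF Suc.prems(2)]])
  have "measure_pmf.expectation p
      (\<lambda>\<phi>. w \<phi> * measure_pmf.expectation (run_policy \<sigma> \<phi> (Suc n) Z) (\<lambda>Y. g Y \<phi>)) =
    measure_pmf.expectation p (\<lambda>\<phi>. v None \<phi> * g Z \<phi> + (\<Sum>e\<in>E - Z. v (Some e) \<phi> * ?r e \<phi>))"
    using Suc.prems(2)
    by (intro integral_cong_pmf)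
      (simp add: run_policy_Suc_expectation v_def distrib_left sum_distrib_left mult.assoc
        del: run_policy.simps)
  also have "\<dots> = measure_pmf.expectation p (\<lambda>\<phi>. v None \<phi> * g Z \<phi>) +
      (\<Sum>e\<in>E - Z. measure_pmf.expectation p (\<lambda>\<phi>. v (Some e) \<phi> * ?r e \<phi>))"
    using int_r int_g by (subst Bochner_Integration.integral_add) auto
  also have "\<dots> \<le> measure_pmf.expectation p (\<lambda>\<phi>. v None \<phi> * g Z \<phi>) +
      (\<Sum>e\<in>E - Z. measure_pmf.expectation p (\<lambda>\<phi>. v (Some e) \<phi> * g Z \<phi>))"
  proof (intro add_left_mono sum_mono)
    fix e assume e: "e \<in> E - Z"
    have "measure_pmf.expectation p (\<lambda>\<phi>. v (Some e) \<phi> * ?r e \<phi>) \<le>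
        measure_pmf.expectation p (\<lambda>\<phi>. v (Some e) \<phi> * g (insert e Z) \<phi>)"
      using e Suc.prems(2) by (intro Suc.IH weight_mono[OF v]) auto
    also have "\<dots> \<le> measure_pmf.expectation p (\<lambda>\<phi>. v (Some e) \<phi> * g Z \<phi>)"
      by (rule step[OF v Suc.prems(2) e])
    finally show "measure_pmf.expectation p (\<lambda>\<phi>. v (Some e) \<phi> * ?r e \<phi>) \<le>
        measure_pmf.expectation p (\<lambda>\<phi>. v (Some e) \<phi> * g Z \<phi>)" .
  qed
  also have "\<dots> =
      measure_pmf.expectation p (\<lambda>\<phi>. v None \<phi> * g Z \<phi> + (\<Sum>e\<in>E - Z. v (Some e) \<phi> * g Z \<phi>))"
    using int_g by (subst Bochner_Integration.integral_add) auto
  also have "\<dots> = measure_pmf.expectation p (\<lambda>\<phi>. w \<phi> * g Z \<phi>)"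
  proof (rule integral_cong_pmf)
    fix \<phi> assume "\<phi> \<in> set_pmf p"
    then have "w \<phi> * g Z \<phi> * (pmf (\<sigma> (observed \<phi> Z)) None +
        (\<Sum>e\<in>E - Z. pmf (\<sigma> (observed \<phi> Z)) (Some e))) = w \<phi> * g Z \<phi>"
      using sum_choice Suc.prems(2) by simp
    then show "v None \<phi> * g Z \<phi> + (\<Sum>e\<in>E - Z. v (Some e) \<phi> * g Z \<phi>) = w \<phi> * g Z \<phi>"
      by (simp add: v_def distrib_left sum_distrib_left mult_ac)
  qed
  finally show ?case .
qed simp

lemma weight_pmf_run_policy: "weight p Y (\<lambda>\<phi>. pmf (run_policy \<sigma> \<phi> n Z) Y)"
  by (rule weightI) (auto simp: pmf_le_1 intro: pmf_run_policy_cong)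

end

text \<open>Each selected item outside \<open>B\<close> is charged its truncated marginal at
  \<open>A\<close>. By adaptive submodularity the charge covers the conditional expected gain at the
  moment of selection, however adaptive the choice.\<close>

lemma (in adaptive_submodular_utility) policy_gain_le:
  assumes "admissible_policy E p \<sigma>" "weight p A w" "A \<subseteq> B" "B \<subseteq> E"
  defines "m \<equiv> \<lambda>e \<phi>. max 0 (marginal p u (observed \<phi> A) e)"
  shows "measure_pmf.expectation p
      (\<lambda>\<phi>. w \<phi> * measure_pmf.expectation (run_policy \<sigma> \<phi> n {}) (\<lambda>Y. u (B \<union> Y) \<phi>)) \<le>
    wu w B + measure_pmf.expectation p
      (\<lambda>\<phi>. w \<phi> * measure_pmf.expectation (run_policy \<sigma> \<phi> n {}) (\<lambda>Y. \<Sum>e\<in>Y - B. m e \<phi>))"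
proof -
  interpret admissible_policy E p \<sigma> by fact
  \<comment> \<open>Utility minus charges is a supermartingale along the run; splitting it at the
    end gives the claim.\<close>
  define g where "g Y \<phi> = u (B \<union> Y) \<phi> - (\<Sum>e\<in>Y - B. m e \<phi>)" for Y \<phi>
  have int_m: "integrable p (m e)" if "e \<in> E" for e
    using that assms(3,4) unfolding m_def
    by (intro Bochner_Integration.integrable_max integrable_marginal) auto
  have int_sum: "integrable p (\<lambda>\<phi>. \<Sum>e\<in>Y - B. m e \<phi>)" if "Y \<subseteq> E" for Y
    using that int_m by (intro Bochner_Integration.integrable_sum) auto
  have int_u: "integrable p (u (B \<union> Y))" if "Y \<subseteq> E" for Y
    using that assms(4) by (intro integrable_u) auto
  have int_g: "integrable p (g Y)" if "Y \<subseteq> E" for Y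
    unfolding g_def using that int_u int_sum by (intro Bochner_Integration.integrable_diff) auto
  have step: "measure_pmf.expectation p (\<lambda>\<phi>. v \<phi> * g (insert e Z) \<phi>) \<le>
      measure_pmf.expectation p (\<lambda>\<phi>. v \<phi> * g Z \<phi>)"
    if v: "weight p (B \<union> Z) v" and Z: "Z \<subseteq> E" and e: "e \<in> E - Z" for v Z e
  proof (cases "e \<in> B")
    case True
    then have "g (insert e Z) = g Z" by (auto simp: g_def fun_eq_iff insert_absorb)
    then show ?thesis by simp
  next
    case False
    have fin: "finite (Z - B)" using Z finite_E finite_subset by blast
    have "wu v (insert e (B \<union> Z)) - wu v (B \<union> Z) \<le>
        measure_pmf.expectation p (\<lambda>\<phi>. v \<phi> * marginal p u (observed \<phi> A) e)"
      using False e Z assms(3,4) v by (intro wu_insert_le) auto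
    also have "\<dots> \<le> measure_pmf.expectation p (\<lambda>\<phi>. v \<phi> * m e \<phi>)"
      using e assms(3,4) int_m
      by (intro integral_mono_pmf integrable_weight_mult[OF v] integrable_marginal mult_left_mono
          weight_nonneg[OF v]) (auto simp: m_def)
    finally have gain: "wu v (insert e (B \<union> Z)) - wu v (B \<union> Z) \<le>
      measure_pmf.expectation p (\<lambda>\<phi>. v \<phi> * m e \<phi>)" .
    have "measure_pmf.expectation p (\<lambda>\<phi>. v \<phi> * g (insert e Z) \<phi>) =
        measure_pmf.expectation p (\<lambda>\<phi>. v \<phi> * g Z \<phi> +
          (v \<phi> * u (insert e (B \<union> Z)) \<phi> - v \<phi> * u (B \<union> Z) \<phi>) - v \<phi> * m e \<phi>)"
      using False fin e by (intro integral_cong_pmf)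
        (simp add: g_def insert_Diff_if algebra_simps)
    also have "\<dots> = measure_pmf.expectation p (\<lambda>\<phi>. v \<phi> * g Z \<phi>) +
        (wu v (insert e (B \<union> Z)) - wu v (B \<union> Z)) - measure_pmf.expectation p (\<lambda>\<phi>. v \<phi> * m e \<phi>)"
      using e Z int_m int_g assms(4) unfolding wu_def
      by (simp add: integrable_weight_mult[OF v] integrable_u)
    finally show ?thesis using gain by simp
  qed
  let ?r = "\<lambda>g \<phi>. measure_pmf.expectation (run_policy \<sigma> \<phi> n {}) (\<lambda>Y. g Y \<phi>)"
  have "measure_pmf.expectation p (\<lambda>\<phi>. w \<phi> * ?r g \<phi>) \<le>
      measure_pmf.expectation p (\<lambda>\<phi>. w \<phi> * g {} \<phi>)"
    using assms(2,3) step
    by (intro run_policy_supermartingale[where B = B] int_g weight_mono[OF assms(2)]) auto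
  moreover have "measure_pmf.expectation p (\<lambda>\<phi>. w \<phi> * g {} \<phi>) = wu w B"
    by (simp add: g_def wu_def)
  moreover have "measure_pmf.expectation p (\<lambda>\<phi>. w \<phi> * ?r g \<phi>) =
      measure_pmf.expectation p (\<lambda>\<phi>. w \<phi> * ?r (\<lambda>Y. u (B \<union> Y)) \<phi> - w \<phi> * ?r (\<lambda>Y \<phi>. \<Sum>e\<in>Y - B. m e \<phi>) \<phi>)"
    by (intro integral_cong_pmf)
      (simp add: run_policy_expectation g_def right_diff_distrib sum_subtractf)
  moreover have "\<dots> = measure_pmf.expectation p (\<lambda>\<phi>. w \<phi> * ?r (\<lambda>Y. u (B \<union> Y)) \<phi>) -
      measure_pmf.expectation p (\<lambda>\<phi>. w \<phi> * ?r (\<lambda>Y \<phi>. \<Sum>e\<in>Y - B. m e \<phi>) \<phi>)"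
    using int_u int_sum
    by (intro Bochner_Integration.integral_diff integrable_weight_mult[OF assms(2)]
        integrable_run_policy) auto
  ultimately show ?thesis by simp
qed

section \<open>The execution phase\<close>

text \<open>One task and one outcome \<open>xs\<close> of the initialization are fixed; averaging
  over both is left to the final theorem.\<close>

locale greedy_execution = adaptive_submodular_utility E p u
  for E :: "'e set" and p :: "('e, 'o) realization pmf" and u :: "('e, 'o) utility" +
  fixes k l K :: nat and C :: "('e + nat) list \<Rightarrow> ('e \<rightharpoonup> 'o) \<Rightarrow> ('e + nat) set"
    and xs :: "('e + nat) list"
  assumes l_pos: "0 < l" and K_pos: "0 < K" and k_eq: "k = l + K"
    and rule: "\<And>ys \<psi>. set ys \<subseteq> E <+> {..<k} \<Longrightarrow> l \<le> length ys \<Longrightarrow> length ys < k \<Longrightarrow>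
      partial_real E p \<psi> \<Longrightarrow> dom \<psi> = Inl -` set ys \<Longrightarrow>
      top_set (ext_marginal p u \<psi>) (E <+> {..<k}) K (C ys \<psi>)"
    and xs: "set xs \<subseteq> E <+> {..<k}" "length xs = l"
begin

abbreviation "items ys \<equiv> Inl -` set ys"

definition hist :: "nat \<Rightarrow> ('e + nat) list set" where
  "hist t = {ys. set ys \<subseteq> E <+> {..<k} \<and> length ys = l + t}"

definition cand :: "('e, 'o) realization \<Rightarrow> ('e + nat) list \<Rightarrow> ('e + nat) set" where
  "cand \<phi> ys = C ys (observed \<phi> (items ys))"

text \<open>The candidate set is random through the observed states. Listing its finitely many
  possible values allows working with a fixed \<open>T\<close>.\<close>

definition cands :: "('e + nat) set set" where
  "cands = {T. T \<subseteq> E <+> {..<k} \<and> card T = K}"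

lemma finite_hist: "finite (hist t)"
  unfolding hist_def using finite_E by (intro finite_lists_length_eq) auto

lemma finite_cands: "finite cands"
  by (rule finite_subset[of _ "Pow (E <+> {..<k})"]) (use finite_E in \<open>auto simp: cands_def\<close>)

lemma candsD: "T \<in> cands \<Longrightarrow> T \<subseteq> E <+> {..<k}" "T \<in> cands \<Longrightarrow> card T = K" "T \<in> cands \<Longrightarrow> finite T"
  using K_pos by (auto simp: cands_def intro: card_ge_0_finite)

lemma items_hist: "ys \<in> hist t \<Longrightarrow> items ys \<subseteq> E"
  by (auto simp: hist_def)

lemma cand_top_set:
  assumes "\<phi> \<in> set_pmf p" "ys \<in> hist t" "t < K"
  shows "top_set (ext_marginal p u (observed \<phi> (items ys))) (E <+> {..<k}) K (cand \<phi> ys)"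
  using assms items_hist[OF assms(2)] k_eq
  unfolding cand_def hist_def by (intro rule partial_real_observed) auto

lemma cand_in_cands: "\<phi> \<in> set_pmf p \<Longrightarrow> ys \<in> hist t \<Longrightarrow> t < K \<Longrightarrow> cand \<phi> ys \<in> cands"
  using cand_top_set by (auto simp: cands_def top_set_def)

text \<open>There are \<open>k\<close> dummies of zero marginal but only \<open>K < k\<close>
  candidates, so some dummy is left out or ties with the worst candidate.\<close>

lemma cand_nonneg:
  assumes "\<phi> \<in> set_pmf p" "ys \<in> hist t" "t < K" "y \<in> cand \<phi> ys"
  shows "0 \<le> ext_marginal p u (observed \<phi> (items ys)) y"
proof (rule top_set_nonneg[OF cand_top_set[OF assms(1-3)] _ _ _ _ assms(4)])
  show "Inr ` {..<k} \<subseteq> E <+> {..<k}" by auto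
  show "K < card (Inr ` {..<k} :: ('e + nat) set)"
    using l_pos k_eq by (simp add: card_image)
qed (use finite_E in \<open>auto simp: ext_marginal_def\<close>)

lemma set_pmf_exec_phase:
  assumes "\<phi> \<in> set_pmf p" "t \<le> K"
  shows "set_pmf (exec_phase C \<phi> xs t) \<subseteq> hist t"
  using assms(2)
proof (induction t)
  case 0
  then show ?case using xs by (simp add: hist_def)
next
  case (Suc t)
  show ?case
  proof
    fix zs assume "zs \<in> set_pmf (exec_phase C \<phi> xs (Suc t))"
    then obtain ys y where ys: "ys \<in> set_pmf (exec_phase C \<phi> xs t)"
      and y: "y \<in> set_pmf (pmf_of_set (cand \<phi> ys))" "zs = y # ys"
      by (auto simp: cand_def)
    have "ys \<in> hist t" using ys Suc by auto
    moreover from this have T: "cand \<phi> ys \<in> cands"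
      using cand_in_cands assms(1) Suc.prems by simp
    then have "finite (cand \<phi> ys)" "cand \<phi> ys \<noteq> {}"
      using candsD[OF T] K_pos by auto
    then have "y \<in> E <+> {..<k}"
      using y candsD(1)[OF T] by auto
    ultimately show "zs \<in> hist (Suc t)" using y by (simp add: hist_def)
  qed
qed

lemma exec_phase_expectation:
  fixes g :: "('e + nat) list \<Rightarrow> real"
  assumes "\<phi> \<in> set_pmf p" "t \<le> K"
  shows "measure_pmf.expectation (exec_phase C \<phi> xs t) g =
    (\<Sum>ys\<in>hist t. pmf (exec_phase C \<phi> xs t) ys * g ys)"
  using set_pmf_exec_phase[OF assms] finite_hist
  by (subst integral_measure_pmf_real[where A = "hist t"]) (auto simp: mult.commute)

lemma exec_phase_Suc_expectation:
  fixes g :: "('e + nat) list \<Rightarrow> real"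
  assumes "\<phi> \<in> set_pmf p" "t < K"
  shows "measure_pmf.expectation (exec_phase C \<phi> xs (Suc t)) g =
    measure_pmf.expectation (exec_phase C \<phi> xs t)
      (\<lambda>ys. (\<Sum>y\<in>cand \<phi> ys. g (y # ys)) / real K)"
proof -
  have cand: "finite (cand \<phi> ys)" "cand \<phi> ys \<noteq> {}" "card (cand \<phi> ys) = K" if "ys \<in> hist t" for ys
    using candsD[OF cand_in_cands[OF assms(1) that assms(2)]] K_pos by auto
  have "measure_pmf.expectation (exec_phase C \<phi> xs (Suc t)) g =
    (\<Sum>ys\<in>hist t. pmf (exec_phase C \<phi> xs t) ys *\<^sub>R
      measure_pmf.expectation (map_pmf (\<lambda>y. y # ys) (pmf_of_set (cand \<phi> ys))) g)"
    unfolding exec_phase.simps cand_def[symmetric]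
    using set_pmf_exec_phase[OF assms(1), of t] assms(2) finite_hist cand
    by (intro pmf_expectation_bind) auto
  also have "\<dots> = (\<Sum>ys\<in>hist t. pmf (exec_phase C \<phi> xs t) ys *
      ((\<Sum>y\<in>cand \<phi> ys. g (y # ys)) / real K))"
    using cand by (intro sum.cong) (auto simp: integral_pmf_of_set)
  also have "\<dots> = measure_pmf.expectation (exec_phase C \<phi> xs t)
      (\<lambda>ys. (\<Sum>y\<in>cand \<phi> ys. g (y # ys)) / real K)"
    using assms by (intro exec_phase_expectation[symmetric]) auto
  finally show ?thesis .
qed

text \<open>The tails of \<open>ys\<close> are its earlier histories, so every decision leading to
  \<open>ys\<close> used only states of items in \<open>ys\<close>.\<close>

lemma pmf_exec_phase_cong:
  "observed \<phi> (items ys) = observed \<phi>' (items ys) \<Longrightarrow>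
    pmf (exec_phase C \<phi> xs t) ys = pmf (exec_phase C \<phi>' xs t) ys"
proof (induction t arbitrary: ys)
  case (Suc t)
  \<comment> \<open>The only predecessor of a nonempty list is its tail, so the mixture over
    histories collapses to one term.\<close>
  have pmf_Suc: "pmf (exec_phase C \<phi> xs (Suc t)) zs =
      (case zs of [] \<Rightarrow> 0 | y # ys \<Rightarrow> pmf (exec_phase C \<phi> xs t) ys * pmf (pmf_of_set (cand \<phi> ys)) y)"
    for \<phi> zs
  proof (cases zs)
    case Nil
    then have "zs \<notin> set_pmf (exec_phase C \<phi> xs (Suc t))" by auto
    then show ?thesis using Nil by (simp add: pmf_eq_0_set_pmf)
  next
    case (Cons y ys)
    have "pmf (map_pmf (\<lambda>y. y # ys') M) zs = 0" if "ys' \<noteq> ys" for ys' and M :: "('e + nat) pmf"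
      using that Cons by (auto simp: pmf_eq_0_set_pmf)
    moreover have "pmf (map_pmf (\<lambda>y. y # ys) M) zs = pmf M y" for M :: "('e + nat) pmf"
      using Cons pmf_map_inj'[of "\<lambda>y. y # ys" M y] by (simp add: inj_on_def)
    ultimately show ?thesis
      unfolding exec_phase.simps pmf_bind cand_def[symmetric]
      by (subst integral_measure_pmf_real[where A = "{ys}"]) (auto simp: Cons)
  qed
  show ?case
  proof (cases ys)
    case (Cons y zs)
    then have "observed \<phi> (items zs) = observed \<phi>' (items zs)"
      by (intro observed_eq_mono[OF Suc.prems]) auto
    then show ?thesis
      using Suc.IH[of zs] unfolding pmf_Suc by (simp add: Cons cand_def)
  qed (simp only: pmf_Suc list.case)
qed simp

lemma weight_exec_phase: "weight p (items ys) (\<lambda>\<phi>. pmf (exec_phase C \<phi> xs t) ys)"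
  by (rule weightI) (auto simp: pmf_le_1 intro: pmf_exec_phase_cong)

lemma integrable_exec_phase:
  fixes h :: "('e + nat) list \<Rightarrow> ('e, 'o) realization \<Rightarrow> real"
  assumes "\<And>ys. ys \<in> hist t \<Longrightarrow> integrable p (h ys)" "t \<le> K"
  shows "integrable p (\<lambda>\<phi>. measure_pmf.expectation (exec_phase C \<phi> xs t) (\<lambda>ys. h ys \<phi>))"
proof -
  have "integrable p (\<lambda>\<phi>. \<Sum>ys\<in>hist t. pmf (exec_phase C \<phi> xs t) ys * h ys \<phi>)"
    using assms(1) by (intro Bochner_Integration.integrable_sum integrable_mult_bounded)
      (auto simp: pmf_le_1)
  then show ?thesis
    by (rule integrable_cong_AE_imp)
      (auto simp: AE_measure_pmf_iff exec_phase_expectation assms(2))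
qed

section \<open>Utilities during execution, split by history and candidate set\<close>

definition W :: "nat \<Rightarrow> (('e, 'o) realization \<Rightarrow> real) \<Rightarrow> ('e + nat) list \<Rightarrow> ('e + nat) set \<Rightarrow>
    ('e, 'o) realization \<Rightarrow> real" where
  "W t v ys T \<phi> = pmf (exec_phase C \<phi> xs t) ys * v \<phi> * of_bool (cand \<phi> ys = T)"

lemma weight_W:
  assumes "weight p A v"
  shows "weight p (items ys \<union> A) (W t v ys T)"
proof -
  have "weight p (items ys) (\<lambda>\<phi>. of_bool (cand \<phi> ys = T))"
    unfolding cand_def by (rule weight_observed) simp
  then show ?thesis
    unfolding W_def[abs_def]
    by (rule weight_mult[OF weight_mult[OF weight_exec_phase assms Un_upper1 Un_upper2]]) auto
qed

text \<open>In each summand both the history and the candidate set are fixed, so the results on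
  \<open>wu\<close> for fixed sets apply.\<close>

lemma exec_phase_split:
  fixes F :: "('e + nat) list \<Rightarrow> ('e + nat) set \<Rightarrow> ('e, 'o) realization \<Rightarrow> real"
  assumes t: "t < K" and v: "weight p A v"
    and int: "\<And>ys T. ys \<in> hist t \<Longrightarrow> T \<in> cands \<Longrightarrow> integrable p (F ys T)"
  shows "measure_pmf.expectation p
      (\<lambda>\<phi>. v \<phi> * measure_pmf.expectation (exec_phase C \<phi> xs t) (\<lambda>ys. F ys (cand \<phi> ys) \<phi>)) =
    (\<Sum>ys\<in>hist t. \<Sum>T\<in>cands. measure_pmf.expectation p (\<lambda>\<phi>. W t v ys T \<phi> * F ys T \<phi>))"
proof -
  have "v \<phi> * measure_pmf.expectation (exec_phase C \<phi> xs t) (\<lambda>ys. F ys (cand \<phi> ys) \<phi>) =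
      (\<Sum>ys\<in>hist t. \<Sum>T\<in>cands. W t v ys T \<phi> * F ys T \<phi>)" if \<phi>: "\<phi> \<in> set_pmf p" for \<phi>
  proof -
    have "(\<Sum>T\<in>cands. W t v ys T \<phi> * F ys T \<phi>) =
        v \<phi> * (pmf (exec_phase C \<phi> xs t) ys * F ys (cand \<phi> ys) \<phi>)" if "ys \<in> hist t" for ys
    proof -
      have "(\<Sum>T\<in>cands. W t v ys T \<phi> * F ys T \<phi>) =
        (\<Sum>T\<in>cands. if cand \<phi> ys = T then v \<phi> * (pmf (exec_phase C \<phi> xs t) ys * F ys T \<phi>) else 0)"
        by (intro sum.cong) (auto simp: W_def)
      then show ?thesis
        using cand_in_cands[OF \<phi> that t] finite_cands by simp
    qed
    then show ?thesis
      using \<phi> t by (simp add: exec_phase_expectation sum_distrib_left)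
  qed
  then have "measure_pmf.expectation p
      (\<lambda>\<phi>. v \<phi> * measure_pmf.expectation (exec_phase C \<phi> xs t) (\<lambda>ys. F ys (cand \<phi> ys) \<phi>)) =
    measure_pmf.expectation p (\<lambda>\<phi>. \<Sum>ys\<in>hist t. \<Sum>T\<in>cands. W t v ys T \<phi> * F ys T \<phi>)"
    by (rule integral_cong_pmf)
  also have "\<dots> = (\<Sum>ys\<in>hist t. \<Sum>T\<in>cands. measure_pmf.expectation p (\<lambda>\<phi>. W t v ys T \<phi> * F ys T \<phi>))"
    using int by (simp add: integrable_weight_mult[OF weight_W[OF v]])
  finally show ?thesis .
qed

text \<open>The utility after \<open>t\<close> rounds with \<open>A\<close> added. Weight 1 with
  \<open>{}\<close> or \<open>S\<close> for \<open>A\<close> gives the greedy quantities; taking for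
  \<open>v\<close> the probability that the optimal policy ends in \<open>A\<close> gives the terms
  of \<open>Z\<close>.\<close>

definition X :: "nat \<Rightarrow> (('e, 'o) realization \<Rightarrow> real) \<Rightarrow> 'e set \<Rightarrow> real" where
  "X t v A = measure_pmf.expectation p
     (\<lambda>\<phi>. v \<phi> * measure_pmf.expectation (exec_phase C \<phi> xs t) (\<lambda>ys. u (items ys \<union> A) \<phi>))"

definition \<gamma> :: "nat \<Rightarrow> real" where
  "\<gamma> t = measure_pmf.expectation p (\<lambda>\<phi>. measure_pmf.expectation (exec_phase C \<phi> xs t)
     (\<lambda>ys. \<Sum>y\<in>cand \<phi> ys. ext_marginal p u (observed \<phi> (items ys)) y))"

lemma X_0: "X 0 v A = wu v (items xs \<union> A)"
  by (simp add: X_def wu_def)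

lemma X_eq:
  assumes "t < K" "weight p A v" "A \<subseteq> E"
  shows "X t v A = (\<Sum>ys\<in>hist t. \<Sum>T\<in>cands. wu (W t v ys T) (items ys \<union> A))"
  unfolding X_def wu_def using assms(3) items_hist
  by (intro exec_phase_split[OF assms(1,2)] integrable_u) auto

lemma X_Suc_eq:
  assumes "t < K" "weight p A v" "A \<subseteq> E"
  shows "X (Suc t) v A =
    (\<Sum>ys\<in>hist t. \<Sum>T\<in>cands. (\<Sum>y\<in>T. wu (W t v ys T) (items ys \<union> A \<union> Inl -` {y})) / real K)"
proof -
  let ?F = "\<lambda>ys T \<phi>. (\<Sum>y\<in>T. u (items ys \<union> A \<union> Inl -` {y}) \<phi>) / real K"
  have int: "integrable p (u (items ys \<union> A \<union> Inl -` {y}))" if "ys \<in> hist t" "T \<in> cands" "y \<in> T" for ys T y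
    using that items_hist[OF that(1)] candsD(1)[OF that(2)] assms(3) by (intro integrable_u) auto
  have "X (Suc t) v A = measure_pmf.expectation p
      (\<lambda>\<phi>. v \<phi> * measure_pmf.expectation (exec_phase C \<phi> xs t) (\<lambda>ys. ?F ys (cand \<phi> ys) \<phi>))"
    unfolding X_def
  proof (rule integral_cong_pmf)
    fix \<phi> assume \<phi>: "\<phi> \<in> set_pmf p"
    have items_Cons: "items (y # ys) \<union> A = items ys \<union> A \<union> Inl -` {y}" for y ys by auto
    show "v \<phi> * measure_pmf.expectation (exec_phase C \<phi> xs (Suc t)) (\<lambda>ys. u (items ys \<union> A) \<phi>) =
        v \<phi> * measure_pmf.expectation (exec_phase C \<phi> xs t) (\<lambda>ys. ?F ys (cand \<phi> ys) \<phi>)"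
      by (simp only: exec_phase_Suc_expectation[OF \<phi> assms(1)] items_Cons)
  qed
  also have "\<dots> = (\<Sum>ys\<in>hist t. \<Sum>T\<in>cands. measure_pmf.expectation p (\<lambda>\<phi>. W t v ys T \<phi> * ?F ys T \<phi>))"
    using int by (intro exec_phase_split[OF assms(1,2)]) auto
  also have "\<dots> = (\<Sum>ys\<in>hist t. \<Sum>T\<in>cands.
      (\<Sum>y\<in>T. wu (W t v ys T) (items ys \<union> A \<union> Inl -` {y})) / real K)"
    unfolding wu_def using int
    by (intro sum.cong refl)
      (simp add: sum_distrib_left integrable_weight_mult[OF weight_W[OF assms(2)]])
  finally show ?thesis .
qed

lemma integrable_ext_marginal:
  "A \<subseteq> E \<Longrightarrow> y \<in> E <+> {..<k} \<Longrightarrow> integrable p (\<lambda>\<phi>. ext_marginal p u (observed \<phi> A) y)"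
  by (auto simp: ext_marginal_def intro: integrable_marginal)

lemma \<gamma>_eq:
  assumes "t < K"
  shows "\<gamma> t = (\<Sum>ys\<in>hist t. \<Sum>T\<in>cands. \<Sum>y\<in>T. measure_pmf.expectation p
    (\<lambda>\<phi>. W t (\<lambda>_. 1) ys T \<phi> * ext_marginal p u (observed \<phi> (items ys)) y))"
proof -
  have int: "integrable p (\<lambda>\<phi>. ext_marginal p u (observed \<phi> (items ys)) y)"
    if "ys \<in> hist t" "T \<in> cands" "y \<in> T" for ys T y
    using that items_hist[OF that(1)] candsD(1)[OF that(2)] by (intro integrable_ext_marginal) auto
  have "\<gamma> t = (\<Sum>ys\<in>hist t. \<Sum>T\<in>cands. measure_pmf.expectation p
      (\<lambda>\<phi>. W t (\<lambda>_. 1) ys T \<phi> * (\<Sum>y\<in>T. ext_marginal p u (observed \<phi> (items ys)) y)))"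
    unfolding \<gamma>_def using int
    by (subst exec_phase_split[OF assms weight_one, symmetric]) auto
  then show ?thesis
    using int by (simp add: sum_distrib_left integrable_weight_mult[OF weight_W[OF weight_one]])
qed

text \<open>This is \<open>wu_sum_ge\<close> for each history and candidate set, with base
  \<open>items ys \<union> A\<close>.\<close>

lemma X_Suc_ge:
  assumes "t < K" "weight p A v" "A \<subseteq> E"
  shows "(1 - 1 / real K) * X t v A \<le> X (Suc t) v A"
proof -
  have "(1 - 1 / real K) * wu (W t v ys T) (items ys \<union> A) \<le>
      (\<Sum>y\<in>T. wu (W t v ys T) (items ys \<union> A \<union> Inl -` {y})) / real K"
    if "ys \<in> hist t" "T \<in> cands" for ys T
  proof -
    have "(real (card T) - 1) * wu (W t v ys T) (items ys \<union> A) \<le>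
        (\<Sum>y\<in>T. wu (W t v ys T) (items ys \<union> A \<union> Inl -` {y}))"
      using items_hist[OF that(1)] candsD[OF that(2)] assms(3)
      by (intro wu_sum_ge weight_W assms(2)) auto
    then have "(real K - 1) * wu (W t v ys T) (items ys \<union> A) / real K \<le>
        (\<Sum>y\<in>T. wu (W t v ys T) (items ys \<union> A \<union> Inl -` {y})) / real K"
      using candsD(2)[OF that(2)] by (intro divide_right_mono) auto
    moreover have "(real K - 1) * wu (W t v ys T) (items ys \<union> A) / real K =
        (1 - 1 / real K) * wu (W t v ys T) (items ys \<union> A)"
      using K_pos by (simp add: field_simps)
    ultimately show ?thesis by simp
  qed
  then show ?thesis
    unfolding X_eq[OF assms] X_Suc_eq[OF assms] sum_distrib_left by (intro sum_mono) auto
qed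

lemma X_pow_le:
  assumes "t \<le> K" "weight p A v" "A \<subseteq> E"
  shows "(1 - 1 / real K) ^ t * X 0 v A \<le> X t v A"
  using assms(1)
proof (induction t)
  case (Suc t)
  have "(1 - 1 / real K) ^ Suc t * X 0 v A \<le> (1 - 1 / real K) * X t v A"
    using Suc K_pos by (simp only: power_Suc mult.assoc) (intro mult_left_mono, auto)
  also have "\<dots> \<le> X (Suc t) v A" using Suc.prems assms by (intro X_Suc_ge) auto
  finally show ?case .
qed simp

lemma X_Suc_diff:
  assumes "t < K" "weight p A v" "A \<subseteq> E"
  shows "real K * (X (Suc t) v A - X t v A) = (\<Sum>ys\<in>hist t. \<Sum>T\<in>cands. \<Sum>y\<in>T.
    wu (W t v ys T) (items ys \<union> A \<union> Inl -` {y}) - wu (W t v ys T) (items ys \<union> A))"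
proof -
  \<comment> \<open>Each term is spread evenly over the \<open>K\<close> candidates, so that the
    difference can be taken candidate by candidate.\<close>
  have "X t v A = (\<Sum>ys\<in>hist t. \<Sum>T\<in>cands. (\<Sum>y\<in>T. wu (W t v ys T) (items ys \<union> A)) / real K)"
    unfolding X_eq[OF assms] using K_pos by (intro sum.cong refl) (auto simp: candsD(2))
  then show ?thesis
    unfolding X_Suc_eq[OF assms] using K_pos
    by (simp add: sum_subtractf right_diff_distrib flip: sum_divide_distrib)
qed

text \<open>Without an added set the weight is determined by \<open>items ys\<close>, so
  \<open>wu_insert\<close> gives the marginals exactly; for general \<open>A\<close> only an upper
  bound is derived.\<close>

lemma X_Suc_diff_empty:
  assumes "t < K"
  shows "real K * (X (Suc t) (\<lambda>_. 1) {} - X t (\<lambda>_. 1) {}) = \<gamma> t"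
  unfolding X_Suc_diff[OF assms weight_one empty_subsetI] \<gamma>_eq[OF assms]
proof (intro sum.cong refl)
  fix ys T y assume asm: "ys \<in> hist t" "T \<in> cands" "y \<in> T"
  let ?w = "W t (\<lambda>_. 1) ys T"
  have w: "weight p (items ys) ?w" using weight_W[OF weight_one[of p "{}"]] by simp
  show "wu ?w (items ys \<union> {} \<union> Inl -` {y}) - wu ?w (items ys \<union> {}) =
    measure_pmf.expectation p (\<lambda>\<phi>. ?w \<phi> * ext_marginal p u (observed \<phi> (items ys)) y)"
  proof (cases y)
    case (Inl e)
    then have "Inl -` {y} = {e}" "e \<in> E" using candsD(1)[OF asm(2)] asm(3) by auto
    then show ?thesis
      using wu_insert[OF w items_hist[OF asm(1)], of e] Inl by (simp add: ext_marginal_def)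
  next
    case (Inr j)
    then have "Inl -` {y} = {}" by auto
    then show ?thesis using Inr by (simp add: ext_marginal_def)
  qed
qed

text \<open>Outside \<open>A\<close> this is adaptive submodularity; items of \<open>A\<close> gain nothing on the left, while
  the greedy choice has nonnegative marginals thanks to the dummies.\<close>

lemma X_Suc_diff_le:
  assumes "t < K" "A \<subseteq> E"
  shows "X (Suc t) (\<lambda>_. 1) A - X t (\<lambda>_. 1) A \<le> X (Suc t) (\<lambda>_. 1) {} - X t (\<lambda>_. 1) {}"
proof -
  have "real K * (X (Suc t) (\<lambda>_. 1) A - X t (\<lambda>_. 1) A) \<le> \<gamma> t"
    unfolding X_Suc_diff[OF assms(1) weight_one assms(2)] \<gamma>_eq[OF assms(1)]
  proof (intro sum_mono)
    fix ys T y assume asm: "ys \<in> hist t" "T \<in> cands" "y \<in> T"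
    let ?w = "W t (\<lambda>_. 1) ys T"
    have w: "weight p (items ys \<union> A) ?w" using weight_W[OF weight_one] .
    \<comment> \<open>\<open>W\<close> vanishes unless \<open>T\<close> is the candidate set under
      \<open>\<phi>\<close>, so \<open>y\<close> is a greedy candidate wherever the integrand is
      nonzero.\<close>
    have nn: "0 \<le> measure_pmf.expectation p
        (\<lambda>\<phi>. ?w \<phi> * ext_marginal p u (observed \<phi> (items ys)) y)"
      using asm cand_nonneg[OF _ asm(1) assms(1)]
      by (intro integral_nonneg_AE) (auto simp: AE_measure_pmf_iff W_def)
    show "wu ?w (items ys \<union> A \<union> Inl -` {y}) - wu ?w (items ys \<union> A) \<le>
      measure_pmf.expectation p (\<lambda>\<phi>. ?w \<phi> * ext_marginal p u (observed \<phi> (items ys)) y)"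
    proof (cases "Inl -` {y} \<subseteq> items ys \<union> A")
      case True
      then have "items ys \<union> A \<union> Inl -` {y} = items ys \<union> A" by blast
      then show ?thesis using nn by simp
    next
      case False
      then obtain e where e: "y = Inl e" "e \<notin> items ys \<union> A" by (cases y) auto
      then have "Inl -` {y} = {e}" "e \<in> E" using candsD(1)[OF asm(2)] asm(3) by auto
      then show ?thesis
        using wu_insert_le[of "items ys" "items ys \<union> A" e ?w] w e items_hist[OF asm(1)] assms(2)
        by (simp add: ext_marginal_def)
    qed
  qed
  also have "\<gamma> t = real K * (X (Suc t) (\<lambda>_. 1) {} - X t (\<lambda>_. 1) {})"
    by (rule X_Suc_diff_empty[OF assms(1), symmetric])
  finally show ?thesis using K_pos by simp
qed

lemma \<gamma>_nonneg:
  assumes "t < K"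
  shows "0 \<le> \<gamma> t"
  unfolding \<gamma>_def using cand_nonneg assms
  by (intro integral_nonneg_AE)
    (auto simp: AE_measure_pmf_iff exec_phase_expectation intro!: sum_nonneg mult_nonneg_nonneg)

lemma X_diff_le:
  assumes "t \<le> K" "A \<subseteq> E"
  shows "X t (\<lambda>_. 1) A - X 0 (\<lambda>_. 1) A \<le> X t (\<lambda>_. 1) {} - X 0 (\<lambda>_. 1) {}"
  using assms(1)
proof (induction t)
  case (Suc t)
  then show ?case using X_Suc_diff_le[OF _ assms(2), of t] by simp
qed simp

lemma X_mono:
  assumes "t \<le> s" "s \<le> K"
  shows "X t (\<lambda>_. 1) {} \<le> X s (\<lambda>_. 1) {}"
  using assms
proof (induction s rule: dec_induct)
  case (step s)
  have "0 \<le> real K * (X (Suc s) (\<lambda>_. 1) {} - X s (\<lambda>_. 1) {})"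
    using \<gamma>_nonneg[of s] step.prems by (simp add: X_Suc_diff_empty)
  then show ?case using step K_pos by (simp add: zero_le_mult_iff)
qed simp

section \<open>Comparison of the execution with the optimal policy\<close>

context
  fixes \<sigma> :: "('e \<rightharpoonup> 'o) \<Rightarrow> 'e option pmf" and S :: "'e set"
  assumes admissible: "admissible_policy E p \<sigma>"
    and S: "S \<subseteq> E" "card S = l"
    and run_S: "\<And>\<phi> Y. \<phi> \<in> set_pmf p \<Longrightarrow> Y \<in> set_pmf (run_policy \<sigma> \<phi> (card E) {}) \<Longrightarrow>
      S \<subseteq> Y \<and> card Y \<le> k"
begin

interpretation admissible_policy E p \<sigma> by (rule admissible)

abbreviation "run \<phi> \<equiv> run_policy \<sigma> \<phi> (card E) {}"

text \<open>The expected utility of the union of both selections, the two runs being independent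
  given \<open>\<phi>\<close>. The sum over fixed outcomes \<open>Y\<close> has the form that the
  lemmas on \<open>X\<close> ask for: a set with a weight on it.\<close>

definition Z :: "nat \<Rightarrow> real" where
  "Z t = (\<Sum>Y\<in>Pow E. X t (\<lambda>\<phi>. pmf (run \<phi>) Y) Y)"

lemma Z_0: "Z 0 = measure_pmf.expectation p
    (\<lambda>\<phi>. measure_pmf.expectation (run \<phi>) (\<lambda>Y. u (items xs \<union> Y) \<phi>))"
proof -
  have "integrable p (\<lambda>\<phi>. pmf (run \<phi>) Y * u (items xs \<union> Y) \<phi>)" if "Y \<subseteq> E" for Y
    using that xs by (intro integrable_weight_mult[OF weight_pmf_run_policy] integrable_u) auto
  then have "Z 0 = measure_pmf.expectation p (\<lambda>\<phi>. \<Sum>Y\<in>Pow E. pmf (run \<phi>) Y * u (items xs \<union> Y) \<phi>)"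
    unfolding Z_def X_0 wu_def by (subst Bochner_Integration.integral_sum) auto
  also have "\<dots> = measure_pmf.expectation p
      (\<lambda>\<phi>. measure_pmf.expectation (run \<phi>) (\<lambda>Y. u (items xs \<union> Y) \<phi>))"
    by (intro integral_cong_pmf) (simp add: run_policy_expectation)
  finally show ?thesis .
qed

lemma Z_pow_le:
  assumes "t \<le> K"
  shows "(1 - 1 / real K) ^ t * Z 0 \<le> Z t"
  unfolding Z_def sum_distrib_left
  using assms by (intro sum_mono X_pow_le weight_pmf_run_policy) auto

text \<open>The bound holds outcome by outcome: \<open>Y\<close> has at most
  \<open>k - l = K\<close> items outside \<open>S\<close>, and the \<open>K\<close> candidates carry
  the largest marginals.\<close>

lemma run_gain_le:
  assumes "ys \<in> hist t" "t < K" "\<phi> \<in> set_pmf p"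
  defines "B \<equiv> items ys \<union> S"
  shows "measure_pmf.expectation (run \<phi>)
      (\<lambda>Y. \<Sum>e\<in>Y - B. max 0 (marginal p u (observed \<phi> (items ys)) e)) \<le>
    (\<Sum>y\<in>cand \<phi> ys. ext_marginal p u (observed \<phi> (items ys)) y)"
    (is "measure_pmf.expectation _ ?g \<le> ?c")
proof -
  have "?g Y \<le> ?c" if Y: "Y \<in> set_pmf (run \<phi>)" for Y
  proof -
    have YE: "Y \<subseteq> E" using run_policy_subset[OF assms(3) _ Y] by simp
    then have fin: "finite Y" using finite_E finite_subset by blast
    have "card (Y - B) \<le> card (Y - S)"
      unfolding B_def using fin by (intro card_mono) auto
    also have "\<dots> \<le> K"
      using run_S[OF assms(3) Y] S fin card_Diff_subset[of S Y] finite_subset[of S Y] k_eq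
      by auto
    finally have card: "card (Y - B) \<le> K" .
    have "?g Y = (\<Sum>y\<in>Inl ` (Y - B). max 0 (ext_marginal p u (observed \<phi> (items ys)) y))"
      by (simp add: sum.reindex ext_marginal_def)
    also have "\<dots> \<le> ?c"
      using YE finite_E card cand_nonneg[OF assms(3,1,2)]
      by (intro top_set_sum_ge[OF cand_top_set[OF assms(3,1,2)]]) (auto simp: card_image)
    finally show ?thesis .
  qed
  moreover have "finite (set_pmf (run \<phi>))"
  proof (rule finite_subset)
    show "set_pmf (run \<phi>) \<subseteq> Pow E" using run_policy_subset[OF assms(3)] by blast
  qed (use finite_E in simp)
  ultimately have "measure_pmf.expectation (run \<phi>) ?g \<le> measure_pmf.expectation (run \<phi>) (\<lambda>_. ?c)"
    by (intro integral_mono_pmf integrable_measure_pmf_finite)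
  then show ?thesis by simp
qed

text \<open>For each history, \<open>policy_gain_le\<close> charges the optimal run to marginals at
  \<open>items ys\<close>, and \<open>run_gain_le\<close> bounds the charges by the candidates'
  marginals, which average to \<open>\<gamma> t\<close>.\<close>

lemma Z_le:
  assumes "t < K"
  shows "Z t \<le> X t (\<lambda>_. 1) S + \<gamma> t"
proof -
  let ?P = "\<lambda>ys \<phi>. pmf (exec_phase C \<phi> xs t) ys"
  let ?c = "\<lambda>ys \<phi>. \<Sum>y\<in>cand \<phi> ys. ext_marginal p u (observed \<phi> (items ys)) y"
  let ?m = "\<lambda>ys \<phi>. measure_pmf.expectation (run \<phi>)
      (\<lambda>Y. \<Sum>e\<in>Y - (items ys \<union> S). max 0 (marginal p u (observed \<phi> (items ys)) e))"
  have int_u: "integrable p (u (items ys \<union> Y))" if "ys \<in> hist t" "Y \<subseteq> E" for ys Y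
    using that items_hist by (intro integrable_u) auto
  have X: "X t v Y = (\<Sum>ys\<in>hist t. measure_pmf.expectation p
      (\<lambda>\<phi>. ?P ys \<phi> * (v \<phi> * u (items ys \<union> Y) \<phi>)))" if "weight p Y v" "Y \<subseteq> E" for v Y
  proof -
    have "X t v Y = measure_pmf.expectation p
        (\<lambda>\<phi>. \<Sum>ys\<in>hist t. ?P ys \<phi> * (v \<phi> * u (items ys \<union> Y) \<phi>))"
      unfolding X_def using assms
      by (intro integral_cong_pmf) (simp add: exec_phase_expectation sum_distrib_left mult_ac)
    then show ?thesis
      using that int_u
      by (simp add: integrable_weight_mult[OF weight_exec_phase] integrable_weight_mult[OF that(1)])
  qed
  have int_c: "integrable p (?c ys)" if ys: "ys \<in> hist t" for ys
  proof -
    have "integrable p (\<lambda>\<phi>. \<Sum>T\<in>cands. of_bool (cand \<phi> ys = T) *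
        (\<Sum>y\<in>T. ext_marginal p u (observed \<phi> (items ys)) y))"
      using items_hist[OF ys] candsD(1)
      by (intro Bochner_Integration.integrable_sum integrable_mult_bounded integrable_ext_marginal)
        auto
    moreover have "(\<Sum>T\<in>cands. of_bool (cand \<phi> ys = T) *
        (\<Sum>y\<in>T. ext_marginal p u (observed \<phi> (items ys)) y)) = ?c ys \<phi>" if "\<phi> \<in> set_pmf p" for \<phi>
    proof -
      have "(\<Sum>T\<in>cands. of_bool (cand \<phi> ys = T) *
          (\<Sum>y\<in>T. ext_marginal p u (observed \<phi> (items ys)) y)) =
        (\<Sum>T\<in>cands. if cand \<phi> ys = T
          then \<Sum>y\<in>T. ext_marginal p u (observed \<phi> (items ys)) y else 0)"
        by (intro sum.cong) auto
      then show ?thesis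
        using cand_in_cands[OF that ys assms] finite_cands by simp
    qed
    ultimately show ?thesis
      by (rule_tac integrable_cong_AE_imp) (auto simp: AE_measure_pmf_iff)
  qed
  have int_m: "integrable p (?m ys)" if ys: "ys \<in> hist t" for ys
    using items_hist[OF ys]
    by (intro integrable_run_policy Bochner_Integration.integrable_sum
        Bochner_Integration.integrable_max integrable_marginal) auto
  have "Z t = (\<Sum>Y\<in>Pow E. \<Sum>ys\<in>hist t. measure_pmf.expectation p
      (\<lambda>\<phi>. ?P ys \<phi> * (pmf (run \<phi>) Y * u (items ys \<union> Y) \<phi>)))"
    unfolding Z_def by (intro sum.cong refl X weight_pmf_run_policy) auto
  \<comment> \<open>So far \<open>Y\<close> was fixed and histories were averaged; from here on the
    history is fixed and the optimal run is averaged.\<close>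
  also have "\<dots> = (\<Sum>ys\<in>hist t. \<Sum>Y\<in>Pow E. measure_pmf.expectation p
      (\<lambda>\<phi>. ?P ys \<phi> * (pmf (run \<phi>) Y * u (items ys \<union> Y) \<phi>)))"
    by (rule sum.swap)
  also have "\<dots> = (\<Sum>ys\<in>hist t. measure_pmf.expectation p
      (\<lambda>\<phi>. ?P ys \<phi> * measure_pmf.expectation (run \<phi>) (\<lambda>Y. u (items ys \<union> S \<union> Y) \<phi>)))"
  proof (rule sum.cong[OF refl])
    fix ys assume ys: "ys \<in> hist t"
    \<comment> \<open>Every outcome of positive probability contains \<open>S\<close>, so
      \<open>S\<close> joins the base set for free.\<close>
    have eq: "pmf (run \<phi>) Y * u (items ys \<union> Y) \<phi> = pmf (run \<phi>) Y * u (items ys \<union> S \<union> Y) \<phi>"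
      if "\<phi> \<in> set_pmf p" for \<phi> Y
    proof (cases "Y \<in> set_pmf (run \<phi>)")
      case True
      then have "items ys \<union> S \<union> Y = items ys \<union> Y" using run_S[OF that] by blast
      then show ?thesis by simp
    qed (simp add: set_pmf_iff)
    have "measure_pmf.expectation p
        (\<lambda>\<phi>. ?P ys \<phi> * measure_pmf.expectation (run \<phi>) (\<lambda>Y. u (items ys \<union> S \<union> Y) \<phi>)) =
      measure_pmf.expectation p
        (\<lambda>\<phi>. \<Sum>Y\<in>Pow E. ?P ys \<phi> * (pmf (run \<phi>) Y * u (items ys \<union> Y) \<phi>))"
      by (intro integral_cong_pmf) (simp only: run_policy_expectation[OF _ empty_subsetI] sum_distrib_left eq)
    also have "\<dots> = (\<Sum>Y\<in>Pow E. measure_pmf.expectation p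
        (\<lambda>\<phi>. ?P ys \<phi> * (pmf (run \<phi>) Y * u (items ys \<union> Y) \<phi>)))"
      using int_u[OF ys]
      by (intro Bochner_Integration.integral_sum integrable_weight_mult[OF weight_exec_phase]
          integrable_weight_mult[OF weight_pmf_run_policy]) auto
    finally show "(\<Sum>Y\<in>Pow E. measure_pmf.expectation p
        (\<lambda>\<phi>. ?P ys \<phi> * (pmf (run \<phi>) Y * u (items ys \<union> Y) \<phi>))) = measure_pmf.expectation p
        (\<lambda>\<phi>. ?P ys \<phi> * measure_pmf.expectation (run \<phi>) (\<lambda>Y. u (items ys \<union> S \<union> Y) \<phi>))" ..
  qed
  also have "\<dots> \<le> (\<Sum>ys\<in>hist t. wu (?P ys) (items ys \<union> S) +
      measure_pmf.expectation p (\<lambda>\<phi>. ?P ys \<phi> * ?m ys \<phi>))"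
    using items_hist S
    by (intro sum_mono policy_gain_le[OF admissible weight_exec_phase]) auto
  also have "\<dots> = X t (\<lambda>_. 1) S + (\<Sum>ys\<in>hist t. measure_pmf.expectation p (\<lambda>\<phi>. ?P ys \<phi> * ?m ys \<phi>))"
    unfolding X[OF weight_one S(1)] wu_def by (simp add: sum.distrib)
  also have "(\<Sum>ys\<in>hist t. measure_pmf.expectation p (\<lambda>\<phi>. ?P ys \<phi> * ?m ys \<phi>)) \<le>
      (\<Sum>ys\<in>hist t. measure_pmf.expectation p (\<lambda>\<phi>. ?P ys \<phi> * ?c ys \<phi>))"
    using run_gain_le assms
    by (intro sum_mono integral_mono_pmf integrable_weight_mult[OF weight_exec_phase] int_m int_c
        mult_left_mono) auto
  also have "\<dots> = measure_pmf.expectation p (\<lambda>\<phi>. \<Sum>ys\<in>hist t. ?P ys \<phi> * ?c ys \<phi>)"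
    using int_c
    by (intro Bochner_Integration.integral_sum[symmetric] integrable_weight_mult[OF weight_exec_phase])
  also have "\<dots> = \<gamma> t"
    unfolding \<gamma>_def using assms by (intro integral_cong_pmf) (simp add: exec_phase_expectation)
  finally show ?thesis by simp
qed

text \<open>The terms at round 0 depend only on the initial set. Their sum may be positive for a
  single task and outcome; the initialization phase controls its average.\<close>

lemma potential_bound:
  "(1 - 1 / real K) ^ K * Z 0 \<le>
     2 * X K (\<lambda>_. 1) {} + X 0 (\<lambda>_. 1) S - 2 * X 0 (\<lambda>_. 1) {}"
proof -
  let ?x = "\<lambda>t. X t (\<lambda>_. 1) {}" and ?q = "1 - 1 / real K"
  have Z_nonneg: "0 \<le> Z 0"
    unfolding Z_def X_0 using xs by (intro sum_nonneg wu_nonneg[OF weight_pmf_run_policy]) auto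
  have q: "0 \<le> ?q" "?q \<le> 1" using K_pos by auto
  have step: "?q ^ K * Z 0 - ?x K - X 0 (\<lambda>_. 1) S + ?x 0 \<le> real K * (?x (Suc t) - ?x t)"
    if t: "t < K" for t
  proof -
    have "?q ^ K * Z 0 \<le> ?q ^ t * Z 0"
      using q t Z_nonneg by (intro mult_right_mono power_decreasing) auto
    also have "\<dots> \<le> Z t" using t by (intro Z_pow_le) simp
    also have "\<dots> \<le> X t (\<lambda>_. 1) S + \<gamma> t" by (rule Z_le[OF t])
    \<comment> \<open>Gains on top of \<open>S\<close> are first compared with gains without it,
      then extended to round \<open>K\<close>; the bound no longer depends on
      \<open>t\<close>.\<close>
    also have "X t (\<lambda>_. 1) S \<le> ?x K - ?x 0 + X 0 (\<lambda>_. 1) S"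
      using X_diff_le[of t S] X_mono[of t K] t S by simp
    finally show ?thesis using X_Suc_diff_empty[OF t] by simp
  qed
  have "real K * (?q ^ K * Z 0 - ?x K - X 0 (\<lambda>_. 1) S + ?x 0) =
      (\<Sum>t<K. ?q ^ K * Z 0 - ?x K - X 0 (\<lambda>_. 1) S + ?x 0)"
    by simp
  also have "\<dots> \<le> (\<Sum>t<K. real K * (?x (Suc t) - ?x t))"
    by (intro sum_mono step) simp
  also have "\<dots> = real K * (?x K - ?x 0)"
    using sum_lessThan_telescope[of "\<lambda>t. X t (\<lambda>_. 1) {}" K] by (simp flip: sum_distrib_left)
  finally show ?thesis using K_pos by simp
qed

lemma execution_guarantee:
  "(1 - 1 / real K) ^ K * task_utility p (\<lambda>Y. u (items xs \<union> Y)) run \<le>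
     2 * measure_pmf.expectation p
       (\<lambda>\<phi>. measure_pmf.expectation (exec_phase C \<phi> xs K) (\<lambda>ys. u (items ys) \<phi>))
     + exp_utility p u (items xs \<union> S) - 2 * exp_utility p u (items xs)"
  using potential_bound
  by (simp add: Z_0 X_0 X_def[of K] wu_def task_utility_def exp_utility_def)

end

end

section \<open>The initialization phase\<close>

text \<open>No states are observed while the initial set is drawn, so this phase is greedy on a
  deterministic set function. Later \<open>F\<close> is the utility averaged over tasks and
  realizations.\<close>

locale greedy_initialization =
  fixes E :: "'e set" and k l :: nat and F :: "'e set \<Rightarrow> real"
    and U :: "('e + nat) list \<Rightarrow> ('e + nat) set"
  assumes finite_E: "finite E" and l_pos: "0 < l" and l_less: "l < k"
    and submodular: "\<And>A B e. A \<subseteq> B \<Longrightarrow> B \<subseteq> E \<Longrightarrow> e \<in> E - B \<Longrightarrow>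
      F (insert e B) - F B \<le> F (insert e A) - F A"
    and U_top_set: "\<And>xs. set xs \<subseteq> E <+> {..<k} \<Longrightarrow> length xs < l \<Longrightarrow>
      top_set (\<lambda>x. F (Inl -` (set xs \<union> {x})) - F (Inl -` set xs)) (E <+> {..<k}) l (U xs)"
begin

definition init_hist :: "nat \<Rightarrow> ('e + nat) list set" where
  "init_hist n = {xs. set xs \<subseteq> E <+> {..<k} \<and> length xs = n}"

lemma finite_init_hist: "finite (init_hist n)"
  unfolding init_hist_def using finite_E by (intro finite_lists_length_eq) auto

lemma items_init_hist: "xs \<in> init_hist n \<Longrightarrow> Inl -` set xs \<subseteq> E"
  by (auto simp: init_hist_def)

lemma UD:
  assumes "xs \<in> init_hist n" "n < l"
  shows "U xs \<subseteq> E <+> {..<k}" "card (U xs) = l" "finite (U xs)" "U xs \<noteq> {}"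
proof -
  show "U xs \<subseteq> E <+> {..<k}" and card: "card (U xs) = l"
    using U_top_set[of xs] assms by (auto simp: init_hist_def top_set_def)
  show "finite (U xs)" "U xs \<noteq> {}"
    using card l_pos by (auto intro: card_ge_0_finite)
qed

lemma set_pmf_init_phase: "n \<le> l \<Longrightarrow> set_pmf (init_phase U n) \<subseteq> init_hist n"
proof (induction n)
  case (Suc n)
  show ?case
  proof
    fix zs assume "zs \<in> set_pmf (init_phase U (Suc n))"
    then obtain xs x where xs: "xs \<in> set_pmf (init_phase U n)"
      and x: "x \<in> set_pmf (pmf_of_set (U xs))" "zs = x # xs"
      by auto
    have "xs \<in> init_hist n" using xs Suc by auto
    moreover from this have "x \<in> E <+> {..<k}"
      using x UD[of xs n] Suc.prems by auto
    ultimately show "zs \<in> init_hist (Suc n)" using x by (simp add: init_hist_def)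
  qed
qed (simp add: init_hist_def)

abbreviation J :: "nat \<Rightarrow> (('e + nat) list \<Rightarrow> real) \<Rightarrow> real" where
  "J n g \<equiv> measure_pmf.expectation (init_phase U n) g"

lemma integrable_init_phase:
  fixes g :: "('e + nat) list \<Rightarrow> real"
  shows "n \<le> l \<Longrightarrow> integrable (init_phase U n) g"
  by (rule integrable_measure_pmf_finite, rule finite_subset[OF set_pmf_init_phase finite_init_hist])

lemma J_mono: "n \<le> l \<Longrightarrow> (\<And>xs. xs \<in> init_hist n \<Longrightarrow> g xs \<le> h xs) \<Longrightarrow> J n g \<le> J n h"
  using set_pmf_init_phase[of n] by (intro integral_mono_pmf integrable_init_phase) auto

lemma J_cong: "n \<le> l \<Longrightarrow> (\<And>xs. xs \<in> init_hist n \<Longrightarrow> g xs = h xs) \<Longrightarrow> J n g = J n h"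
  using set_pmf_init_phase[of n] by (intro integral_cong_pmf) auto

lemma J_Suc:
  assumes "n < l"
  shows "J (Suc n) g = J n (\<lambda>xs. (\<Sum>x\<in>U xs. g (x # xs)) / real l)"
proof -
  have sub: "set_pmf (init_phase U n) \<subseteq> init_hist n"
    using assms by (intro set_pmf_init_phase) simp
  have "J (Suc n) g = (\<Sum>xs\<in>init_hist n. pmf (init_phase U n) xs *\<^sub>R
      measure_pmf.expectation (map_pmf (\<lambda>x. x # xs) (pmf_of_set (U xs))) g)"
    unfolding init_phase.simps using sub finite_init_hist UD[OF _ assms]
    by (intro pmf_expectation_bind) auto
  also have "\<dots> = (\<Sum>xs\<in>init_hist n. ((\<Sum>x\<in>U xs. g (x # xs)) / real l) * pmf (init_phase U n) xs)"
    using UD[OF _ assms] by (intro sum.cong) (auto simp: integral_pmf_of_set)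
  also have "\<dots> = J n (\<lambda>xs. (\<Sum>x\<in>U xs. g (x # xs)) / real l)"
    using sub finite_init_hist by (subst integral_measure_pmf_real[where A = "init_hist n"]) auto
  finally show ?thesis .
qed

text \<open>The sampling loss in abstract form, since it will be applied to the utility joined with
  the optimal policy's selection instead of \<open>F\<close>.\<close>

lemma J_pow_le:
  assumes Q: "\<And>A T. A \<subseteq> E \<Longrightarrow> T \<subseteq> E <+> {..<k} \<Longrightarrow> card T = l \<Longrightarrow>
      (real l - 1) * Q A \<le> (\<Sum>y\<in>T. Q (A \<union> Inl -` {y}))"
    and "n \<le> l"
  shows "(1 - 1 / real l) ^ n * Q {} \<le> J n (\<lambda>xs. Q (Inl -` set xs))"
  using assms(2)
proof (induction n)
  case (Suc n)
  have items_Cons: "Inl -` set (x # xs) = Inl -` set xs \<union> Inl -` {x}"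
    for x :: "'e + nat" and xs by auto
  have "(1 - 1 / real l) ^ Suc n * Q {} \<le> (1 - 1 / real l) * J n (\<lambda>xs. Q (Inl -` set xs))"
    using Suc l_pos by (simp only: power_Suc mult.assoc) (intro mult_left_mono, auto)
  also have "\<dots> = J n (\<lambda>xs. (1 - 1 / real l) * Q (Inl -` set xs))"
    by simp
  also have "\<dots> \<le> J n (\<lambda>xs. (\<Sum>x\<in>U xs. Q (Inl -` set (x # xs))) / real l)"
  proof (rule J_mono)
    fix xs assume xs: "xs \<in> init_hist n"
    have "(real l - 1) * Q (Inl -` set xs) \<le> (\<Sum>x\<in>U xs. Q (Inl -` set (x # xs)))"
      unfolding items_Cons using Suc.prems UD[OF xs] items_init_hist[OF xs] by (intro Q) auto
    then have "(real l - 1) * Q (Inl -` set xs) / real l \<le>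
        (\<Sum>x\<in>U xs. Q (Inl -` set (x # xs))) / real l"
      by (intro divide_right_mono) auto
    moreover have "(real l - 1) * Q (Inl -` set xs) / real l = (1 - 1 / real l) * Q (Inl -` set xs)"
      using l_pos by (simp add: field_simps)
    ultimately show "(1 - 1 / real l) * Q (Inl -` set xs) \<le>
        (\<Sum>x\<in>U xs. Q (Inl -` set (x # xs))) / real l"
      by simp
  qed (use Suc.prems in simp)
  also have "\<dots> = J (Suc n) (\<lambda>xs. Q (Inl -` set xs))"
    using Suc.prems by (subst J_Suc) auto
  finally show ?case .
qed simp

section \<open>The optimal initial set against the greedy one\<close>

context
  fixes S :: "'e set"
  assumes S: "S \<subseteq> E" "card S \<le> l"
begin

text \<open>An upper bound on what \<open>S\<close> adds to \<open>A\<close>. Truncation keeps it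
  antitone even when items of \<open>S\<close> with negative gain enter \<open>A\<close>, so its
  final value bounds the progress of every round from below.\<close>

definition h :: "'e set \<Rightarrow> real" where
  "h A = (\<Sum>e\<in>S. max 0 (F (insert e A) - F A))"

lemma h_antimono: "A \<subseteq> B \<Longrightarrow> B \<subseteq> E \<Longrightarrow> h B \<le> h A"
  unfolding h_def
proof (rule sum_mono)
  fix e assume "A \<subseteq> B" "B \<subseteq> E" "e \<in> S"
  then show "max 0 (F (insert e B) - F B) \<le> max 0 (F (insert e A) - F A)"
    using submodular[of A B e] S by (cases "e \<in> B") (auto simp: insert_absorb)
qed

lemma union_le_h:
  assumes "A \<subseteq> E"
  shows "F (A \<union> S) - F A \<le> h A"
proof -
  have "finite S" using S finite_E finite_subset by blast
  then have "S \<subseteq> E \<longrightarrow> F (A \<union> S) - F A \<le> (\<Sum>e\<in>S. max 0 (F (insert e A) - F A))"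
  proof induction
    case (insert e S)
    have "F (insert e (A \<union> S)) - F (A \<union> S) \<le> max 0 (F (insert e A) - F A)" if "insert e S \<subseteq> E"
      using submodular[of A "A \<union> S" e] that assms
      by (cases "e \<in> A \<union> S") (auto simp: insert_absorb)
    then show ?case using insert by auto
  qed simp
  then show ?thesis using S by (simp add: h_def)
qed

text \<open>The \<open>l\<close> candidates have the largest gains, nonnegative because of the
  \<open>k > l\<close> dummies, and \<open>S\<close> has at most \<open>l\<close> items.\<close>

lemma h_le_gain:
  assumes xs: "xs \<in> init_hist n" and n: "n < l"
  shows "h (Inl -` set xs) \<le> (\<Sum>x\<in>U xs. F (Inl -` set (x # xs)) - F (Inl -` set xs))"
proof -
  let ?v = "\<lambda>x. F (Inl -` (set xs \<union> {x})) - F (Inl -` set xs)"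
  have top: "top_set ?v (E <+> {..<k}) l (U xs)"
    using U_top_set assms by (simp add: init_hist_def)
  have fin: "finite (E <+> {..<k})" using finite_E by auto
  have Inr: "Inl -` insert (Inr j) (set xs) = Inl -` set xs" for j by auto
  have nn: "0 \<le> ?v x" if "x \<in> U xs" for x
    by (rule top_set_nonneg[OF top fin, of "Inr ` {..<k}"])
      (use that l_less in \<open>auto simp: Inr card_image\<close>)
  have "h (Inl -` set xs) = (\<Sum>x\<in>Inl ` S. max 0 (?v x))"
  proof -
    have "Inl -` (set xs \<union> {Inl e}) = insert e (Inl -` set xs)" for e by auto
    then show ?thesis by (simp add: h_def sum.reindex del: vimage_Un)
  qed
  also have "\<dots> \<le> (\<Sum>x\<in>U xs. ?v x)"
    using S by (intro top_set_sum_ge[OF top fin nn]) (auto simp: card_image)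
  finally show ?thesis by (simp add: Un_commute)
qed

lemma J_h_Suc:
  assumes "n < l"
  shows "J (Suc n) (\<lambda>xs. h (Inl -` set xs)) \<le> J n (\<lambda>xs. h (Inl -` set xs))"
  unfolding J_Suc[OF assms]
proof (rule J_mono)
  fix xs assume xs: "xs \<in> init_hist n"
  have "Inl -` set (x # xs) \<subseteq> E" if "x \<in> U xs" for x
    using that UD(1)[OF xs assms] items_init_hist[OF xs] by auto
  then have "(\<Sum>x\<in>U xs. h (Inl -` set (x # xs))) \<le> (\<Sum>x\<in>U xs. h (Inl -` set xs))"
    by (intro sum_mono h_antimono) auto
  then show "(\<Sum>x\<in>U xs. h (Inl -` set (x # xs))) / real l \<le> h (Inl -` set xs)"
    using UD[OF xs assms] l_pos by (simp add: field_simps)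
qed (use assms in simp)

lemma J_h_antimono: "n \<le> l \<Longrightarrow> J l (\<lambda>xs. h (Inl -` set xs)) \<le> J n (\<lambda>xs. h (Inl -` set xs))"
proof (induction rule: inc_induct)
  case (step n)
  then show ?case using J_h_Suc[of n] by simp
qed simp

text \<open>Each of the \<open>l\<close> rounds gains on average at least \<open>1 / l\<close> of
  the final mean of \<open>h\<close>. Summed up, the total gain covers that mean and hence what
  \<open>S\<close> could still add.\<close>

lemma initialization_guarantee:
  "J l (\<lambda>xs. F (Inl -` set xs \<union> S)) \<le> 2 * J l (\<lambda>xs. F (Inl -` set xs)) - F {}"
proof -
  let ?f = "\<lambda>xs. F (Inl -` set xs)" and ?h = "\<lambda>xs. h (Inl -` set xs)"
  have step: "J l ?h \<le> real l * (J (Suc n) ?f - J n ?f)" if n: "n < l" for n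
  proof -
    have "J l ?h \<le> J n ?h" using n by (intro J_h_antimono) simp
    also have "\<dots> \<le> J n (\<lambda>xs. \<Sum>x\<in>U xs. ?f (x # xs) - ?f xs)"
      using n by (intro J_mono h_le_gain) auto
    also have "\<dots> = J n (\<lambda>xs. real l * ((\<Sum>x\<in>U xs. ?f (x # xs)) / real l - ?f xs))"
      using n l_pos by (intro J_cong) (auto simp: sum_subtractf UD(2)[OF _ n] field_simps)
    also have "\<dots> = real l * (J (Suc n) ?f - J n ?f)"
      using n by (simp only: J_Suc[OF n] integral_mult_right_zero)
        (simp add: integrable_init_phase)
    finally show ?thesis .
  qed
  have "real l * J l ?h = (\<Sum>n<l. J l ?h)" by simp
  also have "\<dots> \<le> (\<Sum>n<l. real l * (J (Suc n) ?f - J n ?f))"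
    by (intro sum_mono step) simp
  also have "\<dots> = real l * (J l ?f - J 0 ?f)"
    using sum_lessThan_telescope[of "\<lambda>n. J n ?f" l] by (simp flip: sum_distrib_left del: init_phase.simps)
  finally have "J l ?h \<le> J l ?f - F {}" using l_pos by simp
  moreover have "J l (\<lambda>xs. F (Inl -` set xs \<union> S) - ?f xs) \<le> J l ?h"
    by (intro J_mono union_le_h items_init_hist) auto
  moreover have "J l (\<lambda>xs. F (Inl -` set xs \<union> S) - ?f xs) = J l (\<lambda>xs. F (Inl -` set xs \<union> S)) - J l ?f"
    by (intro Bochner_Integration.integral_diff integrable_init_phase) auto
  ultimately show ?thesis by simp
qed

end

end

text \<open>This is \<open>wu_sum_ge\<close> for each outcome \<open>Y\<close> with base
  \<open>A \<union> Y\<close>, weighted by the probability of \<open>Y\<close>; it supplies the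
  hypothesis of \<open>J_pow_le\<close>.\<close>

lemma (in adaptive_submodular_utility) policy_union_sum_ge:
  fixes \<sigma> :: "('e \<rightharpoonup> 'o) \<Rightarrow> 'e option pmf"
    and n :: nat
  assumes "admissible_policy E p \<sigma>" "A \<subseteq> E" "finite T" "T \<subseteq> E <+> UNIV"
  defines "Q \<equiv> \<lambda>A. task_utility p (\<lambda>Y. u (A \<union> Y)) (\<lambda>\<phi>. run_policy \<sigma> \<phi> n {})"
  shows "(real (card T) - 1) * Q A \<le> (\<Sum>y\<in>T. Q (A \<union> Inl -` {y}))"
proof -
  interpret admissible_policy E p \<sigma> by fact
  let ?w = "\<lambda>Y \<phi>. pmf (run_policy \<sigma> \<phi> n {}) Y"
  have Q: "Q B = (\<Sum>Y\<in>Pow E. wu (?w Y) (B \<union> Y))" if "B \<subseteq> E" for B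
  proof -
    have "Q B = measure_pmf.expectation p (\<lambda>\<phi>. \<Sum>Y\<in>Pow E. ?w Y \<phi> * u (B \<union> Y) \<phi>)"
      unfolding Q_def task_utility_def by (intro integral_cong_pmf) (simp add: run_policy_expectation)
    then show ?thesis
      using that by (simp add: wu_def integrable_wu[OF weight_pmf_run_policy])
  qed
  have "(real (card T) - 1) * Q A = (\<Sum>Y\<in>Pow E. (real (card T) - 1) * wu (?w Y) (A \<union> Y))"
    by (simp add: Q[OF assms(2)] sum_distrib_left)
  also have "\<dots> \<le> (\<Sum>Y\<in>Pow E. \<Sum>y\<in>T. wu (?w Y) (A \<union> Y \<union> Inl -` {y}))"
    using assms(2-4)
    by (intro sum_mono wu_sum_ge weight_mono[OF weight_pmf_run_policy]) auto
  also have "\<dots> = (\<Sum>y\<in>T. \<Sum>Y\<in>Pow E. wu (?w Y) (A \<union> Inl -` {y} \<union> Y))"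
    by (subst sum.swap) (simp add: Un_ac)
  also have "\<dots> = (\<Sum>y\<in>T. Q (A \<union> Inl -` {y}))"
    using assms(2,4) by (intro sum.cong refl Q[symmetric]) auto
  finally show ?thesis .
qed

section \<open>The guarantee of the two-phase policy\<close>

theorem theorem2:
  fixes E :: "'e set" and Os :: "'o set" and p :: "('e, 'o) realization pmf"
    and G M :: "'g set" and f :: "'g \<Rightarrow> ('e, 'o) utility"
    and l k :: nat
    and U :: "('e + nat) list \<Rightarrow> ('e + nat) set"
    and V :: "'g \<Rightarrow> ('e + nat) list \<Rightarrow> ('e \<rightharpoonup> 'o) \<Rightarrow> ('e + nat) set"
    and \<pi>o :: "('g, 'e, 'o) policy"
  assumes "finite E"
    and "set_pmf p \<subseteq> E \<rightarrow>\<^sub>E Os"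
    and "M \<subseteq> G" and "finite M"
    and "0 < l" and "l < k"
    and "\<And>i Y \<phi>. i \<in> G \<Longrightarrow> Y \<subseteq> E \<Longrightarrow> \<phi> \<in> E \<rightarrow>\<^sub>E Os \<Longrightarrow> 0 \<le> f i Y \<phi>"
    and "\<And>i Y. i \<in> G \<Longrightarrow> Y \<subseteq> E \<Longrightarrow> integrable (measure_pmf p) (\<lambda>\<phi>. f i Y \<phi>)"
    and "\<And>i. i \<in> M \<Longrightarrow> adaptive_submodular E p (f i)"
    and "init_rule E p f M l k U"
    and "exec_rule E p f G l k V"
    and "optimal_policy E p f G M l k \<pi>o"
  shows "avg_utility p f M (two_phase_greedy U V l k)
           \<ge> 1 / 2 * (1 - 1 / real l) ^ l * (1 - 1 / real (k - l)) ^ (k - l)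
             * avg_utility p f M (selected E \<pi>o)"
proof -
  \<comment> \<open>For empty \<open>M\<close> this factor is 0 by the convention on division, and
    both averages vanish.\<close>
  let ?m = "1 / real (card M)" and ?items = "\<lambda>xs. Inl -` set xs :: 'e set"
  define F where "F A = ?m * (\<Sum>i\<in>M. exp_utility p (f i) A)" for A
  define K where "K = k - l"
  have K: "0 < K" "k = l + K" using \<open>l < k\<close> by (auto simp: K_def)
  have utility: "adaptive_submodular_utility E p (f i)" if "i \<in> M" for i
    using that assms(2,3) by unfold_locales (auto intro: assms(1,7,8,9))
  have wu_one: "adaptive_submodular_utility.wu p (f i) (\<lambda>_. 1) = exp_utility p (f i)" if "i \<in> M" for i
    using utility[OF that] by (auto simp: adaptive_submodular_utility.wu_def exp_utility_def)
  have F_nonneg: "0 \<le> F {}"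
    unfolding F_def using adaptive_submodular_utility.wu_nonneg[OF utility weight_one empty_subsetI] wu_one
    by (intro mult_nonneg_nonneg sum_nonneg) auto
  have F_sub: "F (insert e B) - F B \<le> F (insert e A) - F A"
    if "A \<subseteq> B" "B \<subseteq> E" "e \<in> E - B" for A B e
  proof -
    have "exp_utility p (f i) (insert e B) - exp_utility p (f i) B \<le>
        exp_utility p (f i) (insert e A) - exp_utility p (f i) A" if "i \<in> M" for i
      using adaptive_submodular_utility.wu_insert_antimono[OF utility[OF that] \<open>A \<subseteq> B\<close> \<open>B \<subseteq> E\<close> \<open>e \<in> E - B\<close>
          weight_one] wu_one[OF that] by simp
    then have "?m * (\<Sum>i\<in>M. exp_utility p (f i) (insert e B) - exp_utility p (f i) B) \<le>
        ?m * (\<Sum>i\<in>M. exp_utility p (f i) (insert e A) - exp_utility p (f i) A)"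
      by (intro mult_left_mono sum_mono) auto
    then show ?thesis
      unfolding F_def by (simp add: sum_subtractf right_diff_distrib)
  qed
  have gain: "init_gain p f M X = (\<lambda>x. F (Inl -` (X \<union> {x})) - F (Inl -` X))" for X
    unfolding init_gain_def F_def by (simp add: fun_eq_iff sum_subtractf right_diff_distrib)
  interpret init: greedy_initialization E k l F U
    using assms(10) by unfold_locales
      (use assms(1,5,6) F_sub in \<open>auto simp: init_rule_def gain\<close>)
  obtain S where S: "S \<subseteq> E" "card S = l" and \<pi>o: "\<pi>o \<in> \<Omega> E p G S k"
    using assms(12) unfolding optimal_policy_def by blast
  have choice: "set_pmf (\<pi>o i \<psi>) \<subseteq> insert None (Some ` (E - dom \<psi>))"
    and choice_S: "dom \<psi> \<subset> S \<Longrightarrow> set_pmf (\<pi>o i \<psi>) \<subseteq> Some ` (S - dom \<psi>)"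
    if "i \<in> M" "partial_real E p \<psi>" for i \<psi>
    using \<pi>o that subsetD[OF assms(3)] unfolding \<Omega>_def is_policy_def by simp_all
  have finite_S: "finite S" using S(1) assms(1) finite_subset by blast
  have admissible: "admissible_policy E p (\<pi>o i)" if "i \<in> M" for i
  proof
    fix \<phi> A assume "\<phi> \<in> set_pmf p" "A \<subseteq> E"
    then have "partial_real E p (observed \<phi> A)" by (rule partial_real_observed)
    then show "set_pmf (\<pi>o i (observed \<phi> A)) \<subseteq> insert None (Some ` (E - A))"
      using choice[OF \<open>i \<in> M\<close>, of "observed \<phi> A"] by simp
  qed (rule assms(1))
  have run_S: "S \<subseteq> Y \<and> card Y \<le> k"
    if i: "i \<in> M" and \<phi>: "\<phi> \<in> set_pmf p" and Y: "Y \<in> set_pmf (run_policy (\<pi>o i) \<phi> (card E) {})"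
    for i \<phi> Y
  proof
    have "set_pmf (\<pi>o i (observed \<phi> A)) \<subseteq> Some ` (S - A)" if "A \<subset> S" for A
    proof -
      have "partial_real E p (observed \<phi> A)"
        using \<phi> that S(1) by (intro partial_real_observed) auto
      then show ?thesis
        using choice_S[OF i, of "observed \<phi> A"] that by simp
    qed
    then show "S \<subseteq> Y"
      using finite_S card_mono[OF assms(1) S(1)] Y by (intro run_policy_superset[of S]) auto
    show "card Y \<le> k"
      using \<pi>o i \<phi> Y \<open>M \<subseteq> G\<close> unfolding \<Omega>_def selected_def by blast
  qed
  define Q where "Q i A = task_utility p (\<lambda>Y. f i (A \<union> Y)) (selected E \<pi>o i)" for i A
  define x where "x i xs = measure_pmf.expectation p
    (\<lambda>\<phi>. measure_pmf.expectation (exec_phase (V i) \<phi> xs K) (\<lambda>ys. f i (?items ys) \<phi>))" for i xs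
  have exec: "greedy_execution E p (f i) k l K (V i) xs" if "i \<in> M" "xs \<in> init.init_hist l" for i xs
  proof -
    interpret adaptive_submodular_utility E p "f i" by (rule utility[OF that(1)])
    have xs: "set xs \<subseteq> E <+> {..<k}" "length xs = l"
      using that(2) by (auto simp: init.init_hist_def)
    have "i \<in> G" using that(1) assms(3) by blast
    show ?thesis
    proof unfold_locales
      fix ys \<psi>
      assume "set ys \<subseteq> E <+> {..<k}" "l \<le> length ys" "length ys < k" "partial_real E p \<psi>"
        "dom \<psi> = ?items ys"
      then show "top_set (ext_marginal p (f i) \<psi>) (E <+> {..<k}) K (V i ys \<psi>)"
        using assms(11) \<open>i \<in> G\<close> unfolding exec_rule_def K_def by blast
    qed (rule assms(5) K xs)+
  qed
  have exec_bound: "(1 - 1 / real K) ^ K * Q i (?items xs) \<le>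
      2 * x i xs + (exp_utility p (f i) (?items xs \<union> S) - 2 * exp_utility p (f i) (?items xs))"
    if "i \<in> M" "xs \<in> init.init_hist l" for i xs
  proof -
    have "(1 - 1 / real K) ^ K * Q i (?items xs) \<le>
        2 * x i xs + exp_utility p (f i) (?items xs \<union> S) - 2 * exp_utility p (f i) (?items xs)"
      unfolding Q_def x_def selected_def
      by (rule greedy_execution.execution_guarantee[OF exec[OF that] admissible[OF that(1)] S])
        (rule run_S[OF that(1)])
    then show ?thesis by simp
  qed
  \<comment> \<open>The initial list is drawn independently of \<open>\<phi>\<close> and takes
    finitely many values, so the two expectations can be exchanged.\<close>
  have greedy: "task_utility p (f i) (two_phase_greedy U V l k i) = init.J l (x i)" if i: "i \<in> M" for i
  proof -
    let ?e = "\<lambda>xs \<phi>. measure_pmf.expectation (exec_phase (V i) \<phi> xs K) (\<lambda>ys. f i (?items ys) \<phi>)"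
    have sub: "set_pmf (init_phase U l) \<subseteq> init.init_hist l"
      by (rule init.set_pmf_init_phase) simp
    have "task_utility p (f i) (two_phase_greedy U V l k i) =
        measure_pmf.expectation p (\<lambda>\<phi>. \<Sum>xs\<in>init.init_hist l. pmf (init_phase U l) xs * ?e xs \<phi>)"
      unfolding task_utility_def
    proof (rule integral_cong_pmf)
      fix \<phi> assume \<phi>: "\<phi> \<in> set_pmf p"
      have "finite (set_pmf (exec_phase (V i) \<phi> xs K))" if "xs \<in> init.init_hist l" for xs
        using greedy_execution.set_pmf_exec_phase[OF exec[OF i that] \<phi> order.refl]
          greedy_execution.finite_hist[OF exec[OF i that]] finite_subset by blast
      then have "measure_pmf.expectation
          (init_phase U l \<bind> (\<lambda>xs. exec_phase (V i) \<phi> xs K)) (\<lambda>ys. f i (?items ys) \<phi>) =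
        (\<Sum>xs\<in>init.init_hist l. pmf (init_phase U l) xs *\<^sub>R ?e xs \<phi>)"
        using sub init.finite_init_hist by (intro pmf_expectation_bind) auto
      then show "measure_pmf.expectation (two_phase_greedy U V l k i \<phi>) (\<lambda>Y. f i Y \<phi>) =
          (\<Sum>xs\<in>init.init_hist l. pmf (init_phase U l) xs * ?e xs \<phi>)"
        by (simp add: two_phase_greedy_def K_def)
    qed
    also have "\<dots> = (\<Sum>xs\<in>init.init_hist l. pmf (init_phase U l) xs * x i xs)"
    proof -
      have "integrable p (?e xs)" if xs: "xs \<in> init.init_hist l" for xs
      proof -
        interpret greedy_execution E p "f i" k l K "V i" xs by (rule exec[OF i xs])
        show ?thesis
          using items_hist by (intro integrable_exec_phase integrable_u) auto
      qed
      then show ?thesis by (simp add: x_def)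
    qed
    also have "\<dots> = init.J l (x i)"
      using sub init.finite_init_hist
      by (subst integral_measure_pmf_real[where A = "init.init_hist l"]) (auto simp: mult.commute)
    finally show ?thesis .
  qed
  let ?q = "(1 - 1 / real K) ^ K" and ?r = "(1 - 1 / real l) ^ l"
  have q: "0 \<le> ?q" using K by simp
  have task: "?q * ?r * task_utility p (f i) (selected E \<pi>o i) \<le>
      2 * init.J l (x i) + (init.J l (\<lambda>xs. exp_utility p (f i) (?items xs \<union> S)) -
        2 * init.J l (\<lambda>xs. exp_utility p (f i) (?items xs)))" if i: "i \<in> M" for i
  proof -
    \<comment> \<open>Sampling the initial set keeps the fraction \<open>?r\<close> of the optimal
      utility \<open>Q i {}\<close>; the execution bound then applies inside the average over
      initial lists.\<close>
    have "?r * Q i {} \<le> init.J l (\<lambda>xs. Q i (?items xs))"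
    proof (rule init.J_pow_le)
      fix A :: "'e set" and T :: "('e + nat) set"
      assume A: "A \<subseteq> E" "T \<subseteq> E <+> {..<k}" "card T = l"
      have T: "finite T" "T \<subseteq> E <+> UNIV" using A \<open>0 < l\<close>
        by (auto intro: card_ge_0_finite)
      show "(real l - 1) * Q i A \<le> (\<Sum>y\<in>T. Q i (A \<union> Inl -` {y}))"
        using adaptive_submodular_utility.policy_union_sum_ge[OF utility[OF i] admissible[OF i]
            A(1) T, of "card E"]
        unfolding Q_def selected_def A(3) .
    qed simp
    then have "?q * (?r * Q i {}) \<le> ?q * init.J l (\<lambda>xs. Q i (?items xs))"
      using q by (rule mult_left_mono)
    also have "\<dots> = init.J l (\<lambda>xs. ?q * Q i (?items xs))" by simp
    also have "\<dots> \<le> init.J l (\<lambda>xs. 2 * x i xs + (exp_utility p (f i) (?items xs \<union> S) -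
        2 * exp_utility p (f i) (?items xs)))"
      by (intro init.J_mono exec_bound[OF i]) auto
    also have "\<dots> = 2 * init.J l (x i) + (init.J l (\<lambda>xs. exp_utility p (f i) (?items xs \<union> S)) -
        2 * init.J l (\<lambda>xs. exp_utility p (f i) (?items xs)))"
      by (simp add: init.integrable_init_phase)
    finally show ?thesis by (simp add: Q_def mult.assoc)
  qed
  have J_F: "init.J l (\<lambda>xs. F (g xs)) = ?m * (\<Sum>i\<in>M. init.J l (\<lambda>xs. exp_utility p (f i) (g xs)))" for g
    unfolding F_def by (simp add: init.integrable_init_phase)
  have "?q * ?r * avg_utility p f M (selected E \<pi>o) =
      ?m * (\<Sum>i\<in>M. ?q * ?r * task_utility p (f i) (selected E \<pi>o i))"
    by (simp add: avg_utility_def sum_distrib_left)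
  also have "\<dots> \<le> ?m * (\<Sum>i\<in>M. 2 * init.J l (x i) +
      (init.J l (\<lambda>xs. exp_utility p (f i) (?items xs \<union> S)) -
        2 * init.J l (\<lambda>xs. exp_utility p (f i) (?items xs))))"
    using task by (intro mult_left_mono sum_mono) auto
  also have "\<dots> = 2 * avg_utility p f M (two_phase_greedy U V l k) +
      (init.J l (\<lambda>xs. F (?items xs \<union> S)) - 2 * init.J l (\<lambda>xs. F (?items xs)))"
    unfolding avg_utility_def J_F
    by (simp add: greedy sum.distrib sum_subtractf add_divide_distrib diff_divide_distrib
        flip: sum_distrib_left)
  \<comment> \<open>Only the task average of the remainder is controlled: by
    \<open>initialization_guarantee\<close> it is at most \<open>- F {}\<close>.\<close>
  also have "\<dots> \<le> 2 * avg_utility p f M (two_phase_greedy U V l k)"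
    using init.initialization_guarantee[of S] S F_nonneg by simp
  finally show ?thesis
    by (simp add: K_def mult_ac)
qed

end
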